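(* Let $\omega\in[0,N]$ and $\xi\in\Xi_N$. (a) If $\omega\in[0,N]\setminus\mathbb Z$, then $\mathcal A_\omega(\cdot\,;2\pi)$ attains its minimum on the set of loops in $\Lambda^{D_N}_\xi$ satisfying $[z_0]=0$. (b) If $\omega\in\{0,N\}$, then $\mathcal A_\omega(\cdot\,;2\pi)$ attains its minimum on the set of loops in $\Lambda^{D_N}_\xi$ satisfying $[x_0]=0$ and $[z_0]=0$.
   Context: Fix an integer $N\ge2$ and let $\mathbf N=\{0,\dots,N-1\}$. Consider unit masses with positions $q_i=(x_i,y_i,z_i)\in\mathbb R^3$, and write $\zeta_i=x_i+\mathrm i y_i\in\mathbb C$, so that $q_i=(\zeta_i,z_i)$. - Potential: $U(q)=\sum_{i<j}1/|q_i-q_j|$. - Collision set: $\Delta=\{q:q_i=q_j\text{ for some }i\ne j\}$. - Loop space: $\Lambda=H^1(\mathbb R/2\pi\mathbb Z,\mathbb R^{3N})$. - Rotating-frame action: for $\omega\in\mathbb R$, $\mathcal A_\omega(q;T_1,T_2)=\int_{T_1}^{T_2}\big(\tfrac12\sum_i(|\dot\zeta_i+\mathrm i\omega\zeta_i|^2+\dot z_i^2)+U(q)\big)dt$, and $\mathcal A_\omega(q;T)=\mathcal A_\omega(q;0,T)$. (This is the action in a frame rotating about the $z$-axis with angular velocity $\omega$.) - Means: $[x_0]=\frac1{2\pi}\int_0^{2\pi}x_0$ and $[z_0]=\frac1{2\pi}\int_0^{2\pi}z_0$. - Reflection: $\mathfrak R_{xz}(x,y,z)=(x,-y,z)$. -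 $D_N$-symmetric loops: $\Lambda^{D_N}=\{q\in\Lambda: q_i(t)=q_0(t+2\pi i/N),\ q_0(2\pi-t)=\mathfrak R_{xz}q_0(t)\ \forall t\}$. - Sign data: for collision-free $q\in\Lambda^{D_N}$, $y_0(k\pi/N)\ne0$ for $k=1,\dots,N-1$. Let $\Xi_N=\{\pm1\}^{N-1}$. - Topological classes: $\Lambda^{D_N}_\xi$ is the weak $H^1$-closure in $\Lambda^{D_N}$ of the collision-free $q\in\Lambda^{D_N}$ with $\operatorname{sign}y_0(k\pi/N)=\xi_k$ for all $k$. *)

theory Defs
  imports "HOL-Analysis.Analysis"
begin

text \<open>A loop configuration: body index i (only i < N matters) and time t;
  q i t = (zeta_i(t), z_i(t)) in C x R = R^3.\<close>
type_synonym loop = "nat \<Rightarrow> real \<Rightarrow> complex \<times> real"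

definition is_wderiv :: "(real \<Rightarrow> 'a::euclidean_space) \<Rightarrow> (real \<Rightarrow> 'a) \<Rightarrow> bool" where
  "is_wderiv f g \<longleftrightarrow> g \<in> borel_measurable lborel
     \<and> (\<forall>a b. set_integrable lborel {a..b} g)
     \<and> set_integrable lborel {0..2*pi} (\<lambda>t. (norm (g t))^2)
     \<and> (\<forall>a b. a \<le> b \<longrightarrow> f b - f a = (LINT t:{a..b}|lborel. g t))"

text \<open>2pi-periodic H^1 function (continuous representative).\<close>
definition H1_loop :: "(real \<Rightarrow> 'a::euclidean_space) \<Rightarrow> bool" where
  "H1_loop f \<longleftrightarrow> (\<forall>t. f (t + 2*pi) = f t) \<and> (\<exists>g. is_wderiv f g)"

definition wderiv :: "(real \<Rightarrow> 'a::euclidean_space) \<Rightarrow> real \<Rightarrow> 'a" where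
  "wderiv f = (SOME g. is_wderiv f g)"

definition in_Lambda :: "nat \<Rightarrow> loop \<Rightarrow> bool" where
  "in_Lambda N q \<longleftrightarrow> (\<forall>i<N. H1_loop (q i))"

definition H1_inner :: "nat \<Rightarrow> loop \<Rightarrow> loop \<Rightarrow> real" where
  "H1_inner N q p = (\<Sum>i<N. LINT t:{0..2*pi}|lborel.
      (q i t \<bullet> p i t + wderiv (q i) t \<bullet> wderiv (p i) t))"

definition refl_xz :: "complex \<times> real \<Rightarrow> complex \<times> real" where
  "refl_xz w = (cnj (fst w), snd w)"

definition Lambda_DN :: "nat \<Rightarrow> loop \<Rightarrow> bool" where
  "Lambda_DN N q \<longleftrightarrow> in_Lambda N q
     \<and> (\<forall>i<N. \<forall>t. q i t = q 0 (t + 2*pi*real i / real N))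
     \<and> (\<forall>t. q 0 (2*pi - t) = refl_xz (q 0 t))"

definition collision_free :: "nat \<Rightarrow> loop \<Rightarrow> bool" where
  "collision_free N q \<longleftrightarrow> (\<forall>t. \<forall>i<N. \<forall>j<N. i \<noteq> j \<longrightarrow> q i t \<noteq> q j t)"

definition DN_core :: "nat \<Rightarrow> (nat \<Rightarrow> real) \<Rightarrow> loop set" where
  "DN_core N \<xi> = {q. Lambda_DN N q \<and> collision_free N q \<and>
     (\<forall>k\<in>{1..N-1}. sgn (Im (fst (q 0 (real k * pi / real N)))) = \<xi> k)}"

text \<open>Closure in Lambda^{D_N} for the weak H^1 topology (topological, via
  basic weak neighbourhoods given by finitely many test loops).\<close>
definition weak_closure_DN :: "nat \<Rightarrow> loop set \<Rightarrow> loop set" where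
  "weak_closure_DN N S = {q. Lambda_DN N q \<and>
     (\<forall>H. finite H \<longrightarrow> H \<subseteq> {h. in_Lambda N h} \<longrightarrow>
        (\<forall>\<epsilon>>0. \<exists>p\<in>S. \<forall>h\<in>H. \<bar>H1_inner N p h - H1_inner N q h\<bar> < \<epsilon>))}"

definition Lambda_DN_xi :: "nat \<Rightarrow> (nat \<Rightarrow> real) \<Rightarrow> loop set" where
  "Lambda_DN_xi N \<xi> = weak_closure_DN N (DN_core N \<xi>)"

definition potential :: "nat \<Rightarrow> (nat \<Rightarrow> complex \<times> real) \<Rightarrow> ennreal" where
  "potential N x = (if \<exists>i<N. \<exists>j<N. i \<noteq> j \<and> x i = x j then \<infinity>
     else (\<Sum>i<N. \<Sum>j\<in>{i<..<N}. ennreal (1 / norm (x i - x j))))"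

definition action :: "nat \<Rightarrow> real \<Rightarrow> loop \<Rightarrow> real \<Rightarrow> real \<Rightarrow> ennreal" where
  "action N \<omega> q T1 T2 = (\<integral>\<^sup>+ t \<in> {T1..T2}.
      (ennreal (1/2 * (\<Sum>i<N. (cmod (fst (wderiv (q i) t) + \<i> * complex_of_real \<omega> * fst (q i t)))^2
                               + (snd (wderiv (q i) t))^2))
       + potential N (\<lambda>i. q i t)) \<partial>lborel)"

definition mean_x0 :: "loop \<Rightarrow> real" where
  "mean_x0 q = 1 / (2*pi) * (LINT t:{0..2*pi}|lborel. Re (fst (q 0 t)))"

definition mean_z0 :: "loop \<Rightarrow> real" where
  "mean_z0 q = 1 / (2*pi) * (LINT t:{0..2*pi}|lborel. snd (q 0 t))"

end

theory Submission
  imports Defs "HOL-Complex_Analysis.Great_Picard" "HOL-Library.Real_Mod" "HOL-Library.Periodic_Fun"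
begin

text \<open>The direct method. A bound on the action bounds the rotating-frame velocity
  \<open>\<zeta>' + \<i>\<omega>\<zeta>\<close> in \<open>L\<^sup>2\<close>, and \<open>exp (\<i>\<omega>t) (\<zeta>' + \<i>\<omega>\<zeta>)\<close> is the derivative of \<open>exp (\<i>\<omega>t) \<zeta>\<close>. This bounds the
  oscillation of \<open>exp (\<i>\<omega>t) \<zeta>\<^sub>0\<close> and, by periodicity, \<open>(exp (2\<pi>\<i>\<omega>) - 1) \<zeta>\<^sub>0(0)\<close>, which is coercive if \<open>\<omega>\<close>
  is not an integer. For \<open>\<omega> = 0\<close> the mean of \<open>x\<^sub>0\<close> supplies the missing control, and for \<open>\<omega> = N\<close> one
  first subtracts the symmetry \<open>\<zeta>\<^sub>0(0) exp (- \<i>Nt)\<close>.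
  A minimising sequence then converges uniformly along a subsequence by Arzela-Ascoli, its derivatives
  converge weakly in \<open>L\<^sup>2\<close> by Mazur's convexity argument, and the action is lower semicontinuous by
  convexity of the kinetic part and Fatou's lemma for the potential. The class is nonempty because
  \<open>(\<i> sin t P(cos t), cos t)\<close> is collision-free with prescribed signs for a suitable interpolation
  polynomial \<open>P\<close>.\<close>

section \<open>Square-integrable functions\<close>

definition sq_integrable :: "'a measure \<Rightarrow> ('a \<Rightarrow> 'b::euclidean_space) \<Rightarrow> bool" where
  "sq_integrable M f \<longleftrightarrow> f \<in> borel_measurable M \<and> integrable M (\<lambda>x. (norm (f x))\<^sup>2)"

definition L2_inner :: "'a measure \<Rightarrow> ('a \<Rightarrow> 'b::euclidean_space) \<Rightarrow> ('a \<Rightarrow> 'b) \<Rightarrow> real" where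
  "L2_inner M f g = (\<integral>x. f x \<bullet> g x \<partial>M)"

definition energy :: "'a measure \<Rightarrow> ('a \<Rightarrow> 'b::euclidean_space) \<Rightarrow> real" where
  "energy M f = (\<integral>x. (norm (f x))\<^sup>2 \<partial>M)"

lemma sq_integrable_measurable: "sq_integrable M f \<Longrightarrow> f \<in> borel_measurable M"
  by (simp add: sq_integrable_def)

lemma sq_integrable_norm_square: "sq_integrable M f \<Longrightarrow> integrable M (\<lambda>x. (norm (f x))\<^sup>2)"
  by (simp add: sq_integrable_def)

lemma energy_nonneg: "0 \<le> energy M f"
  by (simp add: energy_def)

lemma L2_inner_self: "L2_inner M f f = energy M f"
  by (simp add: L2_inner_def energy_def power2_norm_eq_inner)

lemma nn_integral_norm_square:
  assumes "sq_integrable M f"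
  shows "(\<integral>\<^sup>+x. ennreal ((norm (f x))\<^sup>2) \<partial>M) = ennreal (energy M f)"
  using assms by (simp add: sq_integrable_def energy_def nn_integral_eq_integral)

lemma sq_integrableI_nn_integral:
  assumes "f \<in> borel_measurable M" and le: "(\<integral>\<^sup>+x. ennreal ((norm (f x))\<^sup>2) \<partial>M) \<le> ennreal c" and "0 \<le> c"
  shows "sq_integrable M f" and "energy M f \<le> c"
proof -
  show f: "sq_integrable M f"
    unfolding sq_integrable_def using assms(1) le
    by (auto intro!: integrableI_bounded simp: order_le_less_trans[OF _ ennreal_less_top])
  show "energy M f \<le> c"
    using le \<open>0 \<le> c\<close> by (simp add: nn_integral_norm_square[OF f])
qed

lemma sq_integrable_bound:
  assumes f: "sq_integrable M f" and g: "g \<in> borel_measurable M"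
    and le: "\<And>x. x \<in> space M \<Longrightarrow> norm (g x) \<le> c * norm (f x)"
  shows "sq_integrable M g" and "energy M g \<le> c\<^sup>2 * energy M f"
proof -
  have sq_le: "(norm (g x))\<^sup>2 \<le> c\<^sup>2 * (norm (f x))\<^sup>2" if "x \<in> space M" for x
    using power_mono[OF le[OF that] norm_ge_zero, of 2] by (simp add: power_mult_distrib)
  have f_int: "integrable M (\<lambda>x. c\<^sup>2 * (norm (f x))\<^sup>2)"
    using sq_integrable_norm_square[OF f] by simp
  have g_int: "integrable M (\<lambda>x. (norm (g x))\<^sup>2)"
    using g sq_le by (intro Bochner_Integration.integrable_bound[OF f_int] AE_I2) auto
  with g show "sq_integrable M g" by (simp add: sq_integrable_def)
  have "energy M g \<le> (\<integral>x. c\<^sup>2 * (norm (f x))\<^sup>2 \<partial>M)"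
    unfolding energy_def by (intro integral_mono f_int g_int sq_le)
  then show "energy M g \<le> c\<^sup>2 * energy M f" by (simp add: energy_def)
qed

lemma sq_integrable_norm: "sq_integrable M f \<Longrightarrow> sq_integrable M (\<lambda>x. norm (f x))"
  by (auto simp: sq_integrable_def)

lemma energy_norm: "energy M (\<lambda>x. norm (f x)) = energy M f"
  by (simp add: energy_def)

lemma sq_integrable_scaleR: "sq_integrable M f \<Longrightarrow> sq_integrable M (\<lambda>x. c *\<^sub>R f x)"
  by (auto simp: sq_integrable_def power_mult_distrib)

lemma sq_integrable_bounded_linear:
  assumes L: "bounded_linear L" and f: "sq_integrable M f"
  shows "sq_integrable M (\<lambda>x. L (f x))"
proof -
  obtain K where "\<And>x. norm (L x) \<le> norm x * K"
    using bounded_linear.pos_bounded[OF L] by blast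
  then show ?thesis
    using borel_measurable_continuous_on[OF linear_continuous_on[OF L] sq_integrable_measurable[OF f]]
    by (intro sq_integrable_bound(1)[OF f, of _ K]) (auto simp: mult.commute)
qed

lemma integrable_inner:
  assumes f: "sq_integrable M f" and g: "sq_integrable M g"
  shows "integrable M (\<lambda>x. f x \<bullet> g x)"
proof (rule Bochner_Integration.integrable_bound)
  show "integrable M (\<lambda>x. (norm (f x))\<^sup>2 + (norm (g x))\<^sup>2)"
    using f g by (simp add: sq_integrable_def)
  show "(\<lambda>x. f x \<bullet> g x) \<in> borel_measurable M"
    using f g by (auto simp: sq_integrable_def intro: borel_measurable_inner)
  have "\<bar>a \<bullet> b\<bar> \<le> (norm a)\<^sup>2 + (norm b)\<^sup>2" for a b :: 'b
    using Cauchy_Schwarz_ineq2[of a b] sum_squares_bound[of "norm a" "norm b"]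
      mult_nonneg_nonneg[OF norm_ge_zero norm_ge_zero, of a b] by linarith
  then show "AE x in M. norm (f x \<bullet> g x) \<le> norm ((norm (f x))\<^sup>2 + (norm (g x))\<^sup>2)"
    by (intro AE_I2) simp
qed

lemma norm_add_square: "(norm (a + b))\<^sup>2 = (norm a)\<^sup>2 + 2 * (a \<bullet> b) + (norm b)\<^sup>2"
  for a b :: "'b::real_inner"
  by (simp add: power2_norm_eq_inner inner_simps inner_commute)

lemma sq_integrable_add:
  assumes "sq_integrable M f" "sq_integrable M g"
  shows "sq_integrable M (\<lambda>x. f x + g x)"
  using assms integrable_inner[OF assms] by (auto simp: sq_integrable_def norm_add_square)

lemma sq_integrable_diff:
  assumes f: "sq_integrable M f" and g: "sq_integrable M g"
  shows "sq_integrable M (\<lambda>x. f x - g x)"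
  using sq_integrable_add[OF f sq_integrable_scaleR[OF g, of "-1"]] by simp

lemma L2_inner_add_left:
  assumes "sq_integrable M f" "sq_integrable M g" "sq_integrable M \<psi>"
  shows "L2_inner M (\<lambda>x. f x + g x) \<psi> = L2_inner M f \<psi> + L2_inner M g \<psi>"
  using assms by (simp add: L2_inner_def inner_add_left integrable_inner)

lemma L2_inner_diff_left:
  assumes "sq_integrable M f" "sq_integrable M g" "sq_integrable M \<psi>"
  shows "L2_inner M (\<lambda>x. f x - g x) \<psi> = L2_inner M f \<psi> - L2_inner M g \<psi>"
  using assms by (simp add: L2_inner_def inner_diff_left integrable_inner)

lemma L2_inner_scaleR_left: "L2_inner M (\<lambda>x. c *\<^sub>R f x) \<psi> = c * L2_inner M f \<psi>"
  by (simp add: L2_inner_def)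

lemma L2_inner_minus_right: "L2_inner M f (\<lambda>x. - \<psi> x) = - L2_inner M f \<psi>"
  by (simp add: L2_inner_def)

lemma energy_scaleR: "energy M (\<lambda>x. c *\<^sub>R f x) = c\<^sup>2 * energy M f"
  by (simp add: energy_def power_mult_distrib)

lemma energy_add:
  assumes "sq_integrable M f" "sq_integrable M g"
  shows "energy M (\<lambda>x. f x + g x) = energy M f + 2 * L2_inner M f g + energy M g"
  using assms integrable_inner[OF assms]
  by (simp add: sq_integrable_def energy_def L2_inner_def norm_add_square)

lemma energy_diff:
  assumes f: "sq_integrable M f" and g: "sq_integrable M g"
  shows "energy M (\<lambda>x. f x - g x) = energy M f - 2 * L2_inner M f g + energy M g"
  using energy_add[OF f sq_integrable_scaleR[OF g, of "-1"]] energy_scaleR[of M "-1" g]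
  by (simp add: L2_inner_minus_right)

lemma energy_add_le:
  assumes "sq_integrable M f" "sq_integrable M g"
  shows "energy M (\<lambda>x. f x + g x) \<le> 2 * energy M f + 2 * energy M g"
  using energy_add[OF assms] energy_diff[OF assms] energy_nonneg[of M "\<lambda>x. f x - g x"] by simp

lemma energy_diff_le_near_midpoint:
  assumes f: "sq_integrable M f" and g: "sq_integrable M g"
    and mid: "d \<le> energy M (\<lambda>x. (1/2) *\<^sub>R (f x + g x))"
    and near: "energy M f \<le> d + \<epsilon>" "energy M g \<le> d + \<epsilon>"
  shows "energy M (\<lambda>x. f x - g x) \<le> 4 * \<epsilon>"
proof -
  have "energy M (\<lambda>x. f x - g x) = 2 * energy M f + 2 * energy M g - 4 * energy M (\<lambda>x. (1/2) *\<^sub>R (f x + g x))"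
    using energy_add[OF f g] energy_diff[OF f g] energy_scaleR[of M "1/2" "\<lambda>x. f x + g x"]
    by (simp add: power2_eq_square)
  with mid near show ?thesis by linarith
qed

lemma energy_cong_AE:
  assumes "sq_integrable M f" "sq_integrable M g" "AE x in M. f x = g x"
  shows "energy M f = energy M g"
  unfolding energy_def
  using assms by (intro integral_cong_AE) (auto dest!: sq_integrable_measurable elim: eventually_mono)

lemma L2_inner_cong_AE:
  assumes "sq_integrable M f" "sq_integrable M g" "sq_integrable M \<psi>" "AE x in M. f x = g x"
  shows "L2_inner M f \<psi> = L2_inner M g \<psi>"
  unfolding L2_inner_def
  using assms by (intro integral_cong_AE) (auto dest!: sq_integrable_measurable elim: eventually_mono)

lemma L2_inner_Cauchy_Schwarz:
  assumes f: "sq_integrable M f" and g: "sq_integrable M g"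
  shows "\<bar>L2_inner M f g\<bar> \<le> sqrt (energy M f * energy M g)"
proof (rule real_le_rsqrt)
  note sq_integrable_measurable[OF f, measurable] sq_integrable_measurable[OF g, measurable]
  have "\<bar>L2_inner M f g\<bar> \<le> (\<integral>x. \<bar>f x \<bullet> g x\<bar> \<partial>M)"
    unfolding L2_inner_def by (rule integral_abs_bound)
  then have "ennreal \<bar>L2_inner M f g\<bar> \<le> (\<integral>\<^sup>+x. ennreal \<bar>f x \<bullet> g x\<bar> \<partial>M)"
    using integrable_inner[OF f g] by (simp add: nn_integral_eq_integral ennreal_leI)
  also have "\<dots> \<le> (\<integral>\<^sup>+x. ennreal (norm (f x)) * ennreal (norm (g x)) \<partial>M)"
    by (intro nn_integral_mono) (simp add: Cauchy_Schwarz_ineq2 ennreal_leI flip: ennreal_mult)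
  finally have "(ennreal \<bar>L2_inner M f g\<bar>)\<^sup>2 \<le> (\<integral>\<^sup>+x. ennreal (norm (f x)) * ennreal (norm (g x)) \<partial>M)\<^sup>2"
    by (intro power_mono) auto
  also have "\<dots> \<le> (\<integral>\<^sup>+x. (ennreal (norm (f x)))\<^sup>2 \<partial>M) * (\<integral>\<^sup>+x. (ennreal (norm (g x)))\<^sup>2 \<partial>M)"
    by (rule Cauchy_Schwarz_nn_integral) measurable
  also have "\<dots> = ennreal (energy M f * energy M g)"
    by (simp add: ennreal_power nn_integral_norm_square[OF f] nn_integral_norm_square[OF g] energy_nonneg
        flip: ennreal_mult)
  finally show "\<bar>L2_inner M f g\<bar>\<^sup>2 \<le> energy M f * energy M g"
    by (simp add: ennreal_power energy_nonneg)
qed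

lemma L2_inner_tendsto_if_energy_tendsto:
  assumes u: "\<And>n. sq_integrable M (u n)" and g: "sq_integrable M g" and \<psi>: "sq_integrable M \<psi>"
    and lim: "(\<lambda>n. energy M (\<lambda>x. u n x - g x)) \<longlonglongrightarrow> 0"
  shows "(\<lambda>n. L2_inner M (u n) \<psi>) \<longlonglongrightarrow> L2_inner M g \<psi>"
proof -
  have bound: "\<forall>n. norm (L2_inner M (u n) \<psi> - L2_inner M g \<psi>)
      \<le> sqrt (energy M (\<lambda>x. u n x - g x) * energy M \<psi>)"
    using L2_inner_Cauchy_Schwarz[OF sq_integrable_diff[OF u g] \<psi>] L2_inner_diff_left[OF u g \<psi>] by simp
  have "(\<lambda>n. sqrt (energy M (\<lambda>x. u n x - g x) * energy M \<psi>)) \<longlonglongrightarrow> sqrt (0 * energy M \<psi>)"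
    by (intro tendsto_intros lim)
  then have "(\<lambda>n. L2_inner M (u n) \<psi> - L2_inner M g \<psi>) \<longlonglongrightarrow> 0"
    by (intro Lim_null_comparison[OF always_eventually[OF bound]]) simp
  then show ?thesis by (simp add: LIM_zero_iff)
qed

lemma energy_weak_lower_semicontinuous:
  assumes u: "\<And>n. sq_integrable M (u n)" and g: "sq_integrable M g"
    and lim: "(\<lambda>n. L2_inner M (u n) g) \<longlonglongrightarrow> energy M g" and "0 < \<epsilon>"
  shows "\<forall>\<^sub>F n in sequentially. energy M g \<le> energy M (u n) + \<epsilon>"
proof -
  have "\<forall>\<^sub>F n in sequentially. energy M g - \<epsilon> / 2 < L2_inner M (u n) g"
    using \<open>0 < \<epsilon>\<close> by (intro order_tendstoD(1)[OF lim]) simp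
  then show ?thesis
  proof eventually_elim
    case (elim n)
    then show ?case
      using energy_diff[OF u g, of n] energy_nonneg[of M "\<lambda>x. u n x - g x"] by argo
  qed
qed

lemma sq_integrable_AE_limit:
  assumes u: "\<And>n. sq_integrable M (u n)" and g: "g \<in> borel_measurable M"
    and lim: "AE x in M. (\<lambda>n. u n x) \<longlonglongrightarrow> g x"
    and bound: "\<forall>\<^sub>F n in sequentially. energy M (u n) \<le> c" and "0 \<le> c"
  shows "sq_integrable M g" and "energy M g \<le> c"
proof -
  have "(\<integral>\<^sup>+x. ennreal ((norm (g x))\<^sup>2) \<partial>M) = (\<integral>\<^sup>+x. liminf (\<lambda>n. ennreal ((norm (u n x))\<^sup>2)) \<partial>M)"
  proof (intro nn_integral_cong_AE, use lim in eventually_elim)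
    case (elim x)
    then have "(\<lambda>n. ennreal ((norm (u n x))\<^sup>2)) \<longlonglongrightarrow> ennreal ((norm (g x))\<^sup>2)"
      by (intro tendsto_ennrealI tendsto_intros)
    then show ?case
      using lim_imp_Liminf by force
  qed
  also have "\<dots> \<le> liminf (\<lambda>n. \<integral>\<^sup>+x. ennreal ((norm (u n x))\<^sup>2) \<partial>M)"
    using sq_integrable_measurable[OF u] by (intro nn_integral_liminf) measurable
  also have "\<dots> \<le> ennreal c"
    using bound
    by (intro Liminf_le) (auto simp: nn_integral_norm_square[OF u] ennreal_leI elim: eventually_mono)
  finally show "sq_integrable M g" "energy M g \<le> c"
    using sq_integrableI_nn_integral[OF g] \<open>0 \<le> c\<close> by blast+
qed

context finite_measure
begin

lemma sq_integrable_const: "sq_integrable M (\<lambda>x. c)"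
  by (simp add: sq_integrable_def)

lemma sq_integrable_bounded:
  assumes "f \<in> borel_measurable M" "\<And>x. x \<in> space M \<Longrightarrow> norm (f x) \<le> B"
  shows "sq_integrable M f" and "energy M f \<le> measure M (space M) * B\<^sup>2"
  using sq_integrable_bound[OF sq_integrable_const[of "1::real"] assms(1), of B] assms(2)
  by (simp_all add: energy_def mult.commute)

lemma sq_integrable_imp_integrable:
  assumes "sq_integrable M f"
  shows "integrable M f"
proof -
  have "integrable M (\<lambda>x. norm (f x))"
    by (rule square_integrable_imp_integrable) (use assms in \<open>auto simp: sq_integrable_def\<close>)
  then show ?thesis
    using sq_integrable_measurable[OF assms] by (simp add: integrable_norm_iff)
qed

lemma integral_norm_le_sqrt_energy:
  assumes f: "sq_integrable M f"
  shows "(\<integral>x. norm (f x) \<partial>M) \<le> sqrt (measure M (space M) * energy M f)"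
  using L2_inner_Cauchy_Schwarz[OF sq_integrable_norm[OF f] sq_integrable_const[of 1]]
  by (simp add: L2_inner_def energy_def mult.commute)

lemma AE_convergent_subseq_if_L2_Cauchy:
  fixes u :: "nat \<Rightarrow> 'a \<Rightarrow> 'b::euclidean_space"
  assumes u: "\<And>n. sq_integrable M (u n)"
    and Cauchy: "\<And>e. 0 < e \<Longrightarrow> \<exists>k. \<forall>m\<ge>k. \<forall>n\<ge>k. energy M (\<lambda>x. u m x - u n x) \<le> e"
  obtains r g where "strict_mono r" "g \<in> borel_measurable M" "AE x in M. (\<lambda>j. u (r j) x) \<longlonglongrightarrow> g x"
proof -
  note sq_integrable_measurable[OF u, measurable]
  define \<mu> where "\<mu> = measure M (space M) + 1"
  have "0 < \<mu>" by (simp add: \<mu>_def add_nonneg_pos)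
  have L1_Cauchy: "\<exists>k. \<forall>m\<ge>k. \<forall>n\<ge>k. (\<integral>x. norm (u m x - u n x) \<partial>M) < e" if "0 < e" for e
  proof -
    obtain k where k: "\<forall>m\<ge>k. \<forall>n\<ge>k. energy M (\<lambda>x. u m x - u n x) \<le> (e/2)\<^sup>2 / \<mu>"
      using Cauchy[of "(e/2)\<^sup>2 / \<mu>"] \<open>0 < e\<close> \<open>0 < \<mu>\<close> by auto
    have "(\<integral>x. norm (u m x - u n x) \<partial>M) < e" if "m \<ge> k" "n \<ge> k" for m n
    proof -
      have "(\<integral>x. norm (u m x - u n x) \<partial>M) \<le> sqrt (measure M (space M) * energy M (\<lambda>x. u m x - u n x))"
        by (rule integral_norm_le_sqrt_energy[OF sq_integrable_diff[OF u u]])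
      also have "\<dots> \<le> sqrt (\<mu> * ((e/2)\<^sup>2 / \<mu>))"
        using k that \<open>0 < \<mu>\<close> by (intro real_sqrt_le_mono mult_mono energy_nonneg) (auto simp: \<mu>_def)
      also have "\<dots> < e" using \<open>0 < e\<close> \<open>0 < \<mu>\<close> by simp
      finally show ?thesis .
    qed
    then show ?thesis by blast
  qed
  obtain r where r: "strict_mono r" "AE x in M. Cauchy (\<lambda>j. u (r j) x)"
    using cauchy_L1_AE_cauchy_subseq[OF sq_integrable_imp_integrable[OF u] L1_Cauchy] by blast
  show ?thesis
  proof (rule that[OF r(1)])
    show "(\<lambda>x. lim (\<lambda>j. u (r j) x)) \<in> borel_measurable M" by measurable
    show "AE x in M. (\<lambda>j. u (r j) x) \<longlonglongrightarrow> lim (\<lambda>j. u (r j) x)"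
      using r(2) by eventually_elim (simp add: Cauchy_convergent_iff convergent_LIMSEQ_iff)
  qed
qed

lemma sq_integrable_complete:
  fixes u :: "nat \<Rightarrow> 'a \<Rightarrow> 'b::euclidean_space"
  assumes u: "\<And>n. sq_integrable M (u n)"
    and Cauchy: "\<And>e. 0 < e \<Longrightarrow> \<exists>k. \<forall>m\<ge>k. \<forall>n\<ge>k. energy M (\<lambda>x. u m x - u n x) \<le> e"
  obtains g where "sq_integrable M g" "(\<lambda>n. energy M (\<lambda>x. u n x - g x)) \<longlonglongrightarrow> 0"
proof -
  obtain r g where r: "strict_mono r" and [measurable]: "g \<in> borel_measurable M"
    and lim: "AE x in M. (\<lambda>j. u (r j) x) \<longlonglongrightarrow> g x"
    using AE_convergent_subseq_if_L2_Cauchy[OF u Cauchy] by blast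
  note sq_integrable_measurable[OF u, measurable]
  have diff_lim: "AE x in M. (\<lambda>j. u n x - u (r j) x) \<longlonglongrightarrow> u n x - g x" for n
    using lim by eventually_elim (intro tendsto_intros)
  have tail: "sq_integrable M (\<lambda>x. u n x - g x) \<and> energy M (\<lambda>x. u n x - g x) \<le> e"
    if "0 < e" "\<forall>m\<ge>k. \<forall>n\<ge>k. energy M (\<lambda>x. u m x - u n x) \<le> e" "n \<ge> k" for e k n
  proof -
    have "\<forall>\<^sub>F j in sequentially. energy M (\<lambda>x. u n x - u (r j) x) \<le> e"
      using eventually_ge_at_top[of k]
      by eventually_elim (use that(2,3) order_trans[OF _ seq_suble[OF r]] in auto)
    then show ?thesis
      using sq_integrable_AE_limit[OF sq_integrable_diff[OF u u] _ diff_lim] \<open>0 < e\<close> by auto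
  qed
  obtain k where "\<forall>m\<ge>k. \<forall>n\<ge>k. energy M (\<lambda>x. u m x - u n x) \<le> 1"
    using Cauchy[of 1] by auto
  then have "sq_integrable M (\<lambda>x. u k x - g x)"
    using tail[of 1 k k] by simp
  then have "sq_integrable M g"
    using sq_integrable_diff[OF u[of k]] by fastforce
  moreover have "(\<lambda>n. energy M (\<lambda>x. u n x - g x)) \<longlonglongrightarrow> 0"
  proof (rule LIMSEQ_I)
    fix e :: real assume "0 < e"
    then obtain k where "\<forall>m\<ge>k. \<forall>n\<ge>k. energy M (\<lambda>x. u m x - u n x) \<le> e / 2"
      using Cauchy[of "e / 2"] by auto
    then have "norm (energy M (\<lambda>x. u n x - g x) - 0) < e" if "n \<ge> k" for n
      using tail[of "e / 2" k n] that \<open>0 < e\<close> energy_nonneg[of M "\<lambda>x. u n x - g x"] by simp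
    then show "\<exists>k. \<forall>n\<ge>k. norm (energy M (\<lambda>x. u n x - g x) - 0) < e" by blast
  qed
  ultimately show ?thesis by (rule that)
qed

end

section \<open>Weak limits of sequences of bounded energy\<close>

text \<open>The closed convex hull, as the intersection of the closed half-spaces containing \<open>X\<close>.\<close>

definition L2_convex_hull :: "'a measure \<Rightarrow> ('a \<Rightarrow> 'b::euclidean_space) set \<Rightarrow> ('a \<Rightarrow> 'b) set" where
  "L2_convex_hull M X = {f. sq_integrable M f \<and>
     (\<forall>\<psi> c. sq_integrable M \<psi> \<longrightarrow> (\<forall>g\<in>X. L2_inner M g \<psi> \<le> c) \<longrightarrow> L2_inner M f \<psi> \<le> c)}"

lemma L2_convex_hull_sq_integrable: "f \<in> L2_convex_hull M X \<Longrightarrow> sq_integrable M f"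
  by (simp add: L2_convex_hull_def)

lemma L2_convex_hull_superset: "f \<in> X \<Longrightarrow> sq_integrable M f \<Longrightarrow> f \<in> L2_convex_hull M X"
  by (simp add: L2_convex_hull_def)

lemma L2_convex_hull_inner_le:
  "f \<in> L2_convex_hull M X \<Longrightarrow> sq_integrable M \<psi> \<Longrightarrow> (\<And>g. g \<in> X \<Longrightarrow> L2_inner M g \<psi> \<le> c) \<Longrightarrow> L2_inner M f \<psi> \<le> c"
  by (simp add: L2_convex_hull_def)

lemma L2_convex_hull_mono: "X \<subseteq> Y \<Longrightarrow> L2_convex_hull M X \<subseteq> L2_convex_hull M Y"
  by (fastforce simp: L2_convex_hull_def)

lemma L2_convex_hull_midpoint:
  assumes "f \<in> L2_convex_hull M X" "g \<in> L2_convex_hull M X"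
  shows "(\<lambda>x. (1/2) *\<^sub>R (f x + g x)) \<in> L2_convex_hull M X"
proof -
  have f: "sq_integrable M f" and g: "sq_integrable M g"
    using assms by (auto dest: L2_convex_hull_sq_integrable)
  have "L2_inner M (\<lambda>x. (1/2) *\<^sub>R (f x + g x)) \<psi> \<le> c"
    if \<psi>: "sq_integrable M \<psi>" and le: "\<forall>h\<in>X. L2_inner M h \<psi> \<le> c" for \<psi> c
  proof -
    have "L2_inner M f \<psi> \<le> c" "L2_inner M g \<psi> \<le> c"
      using assms \<psi> le by (auto intro: L2_convex_hull_inner_le)
    then show ?thesis
      unfolding L2_inner_scaleR_left L2_inner_add_left[OF f g \<psi>] by simp
  qed
  then show ?thesis
    by (simp add: L2_convex_hull_def sq_integrable_scaleR sq_integrable_add f g del: scaleR_add_right)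
qed

lemma near_minimisers_Cauchy:
  fixes A :: "nat \<Rightarrow> ('a \<Rightarrow> 'b::euclidean_space) set"
  assumes sq: "\<And>n f. f \<in> A n \<Longrightarrow> sq_integrable M f" and "decseq A"
    and mid: "\<And>n f g. f \<in> A n \<Longrightarrow> g \<in> A n \<Longrightarrow> (\<lambda>x. (1/2) *\<^sub>R (f x + g x)) \<in> A n"
    and d_le: "\<And>n f. f \<in> A n \<Longrightarrow> d n \<le> energy M f" and "incseq d" and lim: "d \<longlonglongrightarrow> D"
    and u: "\<And>n. u n \<in> A n" and near: "\<And>n. energy M (u n) \<le> d n + 1 / real (Suc n)" and "0 < e"
  shows "\<exists>k. \<forall>m\<ge>k. \<forall>n\<ge>k. energy M (\<lambda>x. u m x - u n x) \<le> e"
proof -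
  define \<epsilon> where "\<epsilon> k = D - d k + 1 / real (Suc k)" for k
  have u_diff: "energy M (\<lambda>x. u m x - u n x) \<le> 4 * \<epsilon> k" if "m \<ge> k" "n \<ge> k" for k m n
  proof (rule energy_diff_le_near_midpoint[OF sq[OF u] sq[OF u]])
    have "energy M (u j) \<le> d k + \<epsilon> k" if "j \<ge> k" for j
    proof -
      have "1 / real (Suc j) \<le> 1 / real (Suc k)" using that by (intro divide_left_mono) auto
      then show ?thesis
        using near[of j] incseq_le[OF \<open>incseq d\<close> lim, of j] by (simp add: \<epsilon>_def)
    qed
    then show "energy M (u m) \<le> d k + \<epsilon> k" "energy M (u n) \<le> d k + \<epsilon> k" using that by auto
    have "u m \<in> A k" "u n \<in> A k"
      using u decseqD[OF \<open>decseq A\<close>] that by blast+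
    then show "d k \<le> energy M (\<lambda>x. (1/2) *\<^sub>R (u m x + u n x))"
      by (intro d_le mid)
  qed
  have "(\<lambda>k. 4 * \<epsilon> k) \<longlonglongrightarrow> 4 * (D - D + 0)"
    unfolding \<epsilon>_def by (intro tendsto_intros lim LIMSEQ_Suc[OF lim_1_over_n])
  then have small: "(\<lambda>k. 4 * \<epsilon> k) \<longlonglongrightarrow> 0" by simp
  obtain k where "4 * \<epsilon> k < e"
    using order_tendstoD(2)[OF small \<open>0 < e\<close>] unfolding eventually_sequentially by blast
  then show ?thesis
    using u_diff by (meson less_imp_le order_trans)
qed

lemma (in finite_measure) midpoint_convex_decseq_converging_selection:
  fixes A :: "nat \<Rightarrow> ('a \<Rightarrow> 'b::euclidean_space) set"
  assumes sq: "\<And>n f. f \<in> A n \<Longrightarrow> sq_integrable M f" and "decseq A"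
    and mid: "\<And>n f g. f \<in> A n \<Longrightarrow> g \<in> A n \<Longrightarrow> (\<lambda>x. (1/2) *\<^sub>R (f x + g x)) \<in> A n"
    and bound: "\<And>n. \<exists>f\<in>A n. energy M f \<le> C"
  obtains u g where "\<And>n. u n \<in> A n" "sq_integrable M g" "(\<lambda>n. energy M (\<lambda>x. u n x - g x)) \<longlonglongrightarrow> 0"
proof -
  define d where "d n = (INF f\<in>A n. energy M f)" for n
  have bdd: "bdd_below (energy M ` A n)" for n
    by (rule bdd_belowI[of _ 0]) (auto simp: energy_nonneg)
  have nonempty: "A n \<noteq> {}" for n
    using bound[of n] by auto
  have d_le: "d n \<le> energy M f" if "f \<in> A n" for f n
    unfolding d_def by (rule cINF_lower[OF bdd that])
  have "incseq d"
    unfolding d_def using nonempty decseqD[OF \<open>decseq A\<close>] by (intro monoI cINF_superset_mono bdd) auto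
  moreover have "d n \<le> C" for n
    using bound d_le order_trans by blast
  ultimately obtain D where "d \<longlonglongrightarrow> D"
    using incseq_convergent by metis
  have "\<exists>f\<in>A n. energy M f \<le> d n + 1 / real (Suc n)" for n
    using cINF_less_iff[of "A n" "energy M" "d n + 1 / real (Suc n)"] nonempty bdd
    by (auto simp: d_def[symmetric] intro: less_imp_le)
  then obtain u where u: "\<And>n. u n \<in> A n" "\<And>n. energy M (u n) \<le> d n + 1 / real (Suc n)"
    by metis
  obtain g where "sq_integrable M g" "(\<lambda>n. energy M (\<lambda>x. u n x - g x)) \<longlonglongrightarrow> 0"
    by (rule sq_integrable_complete[OF sq[OF u(1)]
          near_minimisers_Cauchy[OF sq \<open>decseq A\<close> mid d_le \<open>incseq d\<close> \<open>d \<longlonglongrightarrow> D\<close> u]])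
  with u(1) show ?thesis by (rule that)
qed

lemma L2_inner_le_limit_of_tail_hulls:
  assumes u: "\<And>n. u n \<in> L2_convex_hull M (g ` {n..})" and G: "sq_integrable M G"
    and lim: "(\<lambda>n. energy M (\<lambda>x. u n x - G x)) \<longlonglongrightarrow> 0"
    and \<psi>: "sq_integrable M \<psi>" and \<alpha>: "(\<lambda>n. L2_inner M (g n) \<psi>) \<longlonglongrightarrow> \<alpha>"
  shows "L2_inner M G \<psi> \<le> \<alpha>"
proof (rule field_le_epsilon)
  fix e :: real assume "0 < e"
  then have "\<forall>\<^sub>F n in sequentially. L2_inner M (g n) \<psi> < \<alpha> + e"
    using order_tendstoD(2)[OF \<alpha>, of "\<alpha> + e"] by simp
  then obtain k where k: "\<And>n. n \<ge> k \<Longrightarrow> L2_inner M (g n) \<psi> < \<alpha> + e"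
    unfolding eventually_sequentially by blast
  have "L2_inner M (u n) \<psi> \<le> \<alpha> + e" if "n \<ge> k" for n
  proof (rule L2_convex_hull_inner_le[OF u[of n] \<psi>])
    show "L2_inner M h \<psi> \<le> \<alpha> + e" if "h \<in> g ` {n..}" for h
      using k \<open>n \<ge> k\<close> that by (auto intro: less_imp_le)
  qed
  then show "L2_inner M G \<psi> \<le> \<alpha> + e"
    using L2_inner_tendsto_if_energy_tendsto[OF L2_convex_hull_sq_integrable[OF u] G \<psi> lim]
    by (intro LIMSEQ_le_const2) auto
qed

text \<open>Mazur: a weak limit is a strong limit of elements of the convex hulls of the tails.\<close>

lemma (in finite_measure) bounded_energy_weak_limit:
  fixes g :: "nat \<Rightarrow> 'a \<Rightarrow> 'b::euclidean_space"
  assumes g: "\<And>n. sq_integrable M (g n)" and bound: "\<And>n. energy M (g n) \<le> C"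
  obtains G where "sq_integrable M G"
    "\<And>\<psi> \<alpha>. sq_integrable M \<psi> \<Longrightarrow> (\<lambda>n. L2_inner M (g n) \<psi>) \<longlonglongrightarrow> \<alpha> \<Longrightarrow> L2_inner M G \<psi> = \<alpha>"
proof -
  let ?A = "\<lambda>n. L2_convex_hull M (g ` {n..})"
  obtain u G where u: "\<And>n. u n \<in> ?A n" and G: "sq_integrable M G"
    and lim: "(\<lambda>n. energy M (\<lambda>x. u n x - G x)) \<longlonglongrightarrow> 0"
  proof (rule midpoint_convex_decseq_converging_selection[of ?A C])
    show "decseq ?A"
      by (intro decseq_SucI L2_convex_hull_mono image_mono) auto
    show "\<exists>f\<in>?A n. energy M f \<le> C" for n
      using L2_convex_hull_superset[of "g n" "g ` {n..}"] g bound by blast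
  qed (auto intro: L2_convex_hull_sq_integrable L2_convex_hull_midpoint)
  note le = L2_inner_le_limit_of_tail_hulls[OF u G lim]
  have "L2_inner M G \<psi> = \<alpha>"
    if \<psi>: "sq_integrable M \<psi>" and \<alpha>: "(\<lambda>n. L2_inner M (g n) \<psi>) \<longlonglongrightarrow> \<alpha>" for \<psi> \<alpha>
  proof (rule antisym)
    have "sq_integrable M (\<lambda>x. - \<psi> x)"
      using sq_integrable_scaleR[OF \<psi>, of "-1"] by simp
    moreover have "(\<lambda>n. L2_inner M (g n) (\<lambda>x. - \<psi> x)) \<longlonglongrightarrow> - \<alpha>"
      unfolding L2_inner_minus_right by (intro tendsto_intros \<alpha>)
    ultimately have "L2_inner M G (\<lambda>x. - \<psi> x) \<le> - \<alpha>" by (rule le)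
    then show "\<alpha> \<le> L2_inner M G \<psi>" by (simp add: L2_inner_minus_right)
  qed (rule le[OF \<psi> \<alpha>])
  with G that show ?thesis by blast
qed

section \<open>Integrals over intervals\<close>

interpretation interval_measure: finite_measure "restrict_space lborel {a..b}" for a b :: real
  by (rule finite_measureI) (simp add: emeasure_restrict_space space_restrict_space emeasure_lborel_Icc_eq)

abbreviation period_measure :: "real measure" where
  "period_measure \<equiv> restrict_space lborel {0..2*pi}"

lemma space_period_measure: "space period_measure = {0..2*pi}"
  by (simp add: space_restrict_space)

lemma measure_period_measure: "measure period_measure {0..2*pi} = 2*pi"
  by (simp add: measure_restrict_space)

lemma integrable_interval_iff:
  fixes f :: "real \<Rightarrow> 'a::euclidean_space"
  shows "integrable (restrict_space lborel {a..b}) f \<longleftrightarrow> set_integrable lborel {a..b} f"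
  by (simp add: integrable_restrict_space set_integrable_def)

lemma set_integral_interval:
  fixes f :: "real \<Rightarrow> 'a::euclidean_space"
  shows "(LINT t:{a..b}|lborel. f t) = (\<integral>t. f t \<partial>restrict_space lborel {a..b})"
  by (simp add: integral_restrict_space set_lebesgue_integral_def)

lemma set_integral_subinterval:
  fixes f :: "real \<Rightarrow> 'a::euclidean_space"
  assumes "l \<le> a" "b \<le> u"
  shows "(LINT t:{a..b}|lborel. f t) = (\<integral>t. indicator {a..b} t *\<^sub>R f t \<partial>restrict_space lborel {l..u})"
  using assms by (auto simp: integral_restrict_space set_lebesgue_integral_def
      intro!: Bochner_Integration.integral_cong split: split_indicator)

lemma set_integral_Icc_combine:
  fixes f :: "real \<Rightarrow> 'a::euclidean_space"
  assumes "a \<le> b" "b \<le> c" and int: "set_integrable lborel {a..b} f" "set_integrable lborel {b..c} f"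
  shows "set_integrable lborel {a..c} f"
    and "(LINT t:{a..c}|lborel. f t) = (LINT t:{a..b}|lborel. f t) + (LINT t:{b..c}|lborel. f t)"
proof -
  have "AE t in lborel. \<not> (t \<in> {a..b} \<and> t \<in> {b..c})"
    using AE_lborel_singleton[of b] by eventually_elim auto
  moreover have "{a..c} = {a..b} \<union> {b..c}" using assms(1,2) by auto
  ultimately show "set_integrable lborel {a..c} f"
    "(LINT t:{a..c}|lborel. f t) = (LINT t:{a..b}|lborel. f t) + (LINT t:{b..c}|lborel. f t)"
    using int by (auto intro!: set_integrable_Un set_integral_Un_AE)
qed

lemma set_integrable_mult_continuous:
  fixes f g :: "real \<Rightarrow> 'a::{euclidean_space, real_normed_field}"
  assumes f: "continuous_on {a..b} f" and g: "set_integrable lborel {a..b} g"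
  shows "set_integrable lborel {a..b} (\<lambda>t. f t * g t)"
proof -
  obtain B where B: "\<And>t. t \<in> {a..b} \<Longrightarrow> norm (f t) \<le> B"
    using continuous_on_compact_bound[OF compact_Icc f] by blast
  have f_meas: "(\<lambda>t. indicator {a..b} t *\<^sub>R f t) \<in> borel_measurable lborel"
    using borel_measurable_continuous_on_indicator[OF _ f] by simp
  have g_int: "integrable lborel (\<lambda>t. indicator {a..b} t *\<^sub>R g t)"
    using g by (simp add: set_integrable_def)
  have "integrable lborel (\<lambda>t. (indicator {a..b} t *\<^sub>R f t) * (indicator {a..b} t *\<^sub>R g t))"
  proof (rule Bochner_Integration.integrable_bound)
    show "integrable lborel (\<lambda>t. B * norm (indicator {a..b} t *\<^sub>R g t))"
      using g_int by (intro integrable_mult_right integrable_norm)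
    show "(\<lambda>t. (indicator {a..b} t *\<^sub>R f t) * (indicator {a..b} t *\<^sub>R g t)) \<in> borel_measurable lborel"
      using f_meas borel_measurable_integrable[OF g_int] by (rule borel_measurable_times)
    show "AE t in lborel. norm ((indicator {a..b} t *\<^sub>R f t) * (indicator {a..b} t *\<^sub>R g t))
        \<le> norm (B * norm (indicator {a..b} t *\<^sub>R g t))"
      using B by (intro AE_I2) (auto simp: norm_mult abs_mult split: split_indicator
          intro!: mult_right_mono order_trans[OF B abs_ge_self])
  qed
  moreover have "(indicator {a..b} t *\<^sub>R f t) * (indicator {a..b} t *\<^sub>R g t)
      = indicator {a..b} t *\<^sub>R (f t * g t)" for t
    by (simp split: split_indicator)
  ultimately show ?thesis by (simp only: set_integrable_def)
qed

lemma sq_integrable_indicator: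
  fixes a b l u :: real
  assumes "l \<le> a" "b \<le> u"
  shows "sq_integrable (restrict_space lborel {l..u}) (\<lambda>t. indicator {a..b} t *\<^sub>R e)"
proof -
  have "{a..b} \<in> sets (restrict_space lborel {l..u})"
    using assms by (auto simp: sets_restrict_space_iff)
  then show ?thesis
    by (intro interval_measure.sq_integrable_bounded(1)[of _ _ _ "norm e"]) (auto split: split_indicator)
qed

lemma norm_set_integral_le:
  fixes h :: "real \<Rightarrow> 'a::euclidean_space"
  assumes h: "sq_integrable (restrict_space lborel {l..u}) h" and ab: "l \<le> a" "a \<le> b" "b \<le> u"
  shows "norm (LINT t:{a..b}|lborel. h t) \<le> sqrt ((b - a) * energy (restrict_space lborel {l..u}) h)"
proof -
  let ?M = "restrict_space lborel {l..u}" and ?i = "indicat_real {a..b}"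
  have i: "sq_integrable ?M ?i"
    using sq_integrable_indicator[of l a b u "1::real"] ab by simp
  have "energy ?M ?i = (\<integral>t. ?i t \<partial>?M)"
    unfolding energy_def by (intro Bochner_Integration.integral_cong) (auto split: split_indicator)
  also have "\<dots> = b - a"
    using ab set_integral_subinterval[of l a b u "\<lambda>t. 1::real"] by (simp add: set_lebesgue_integral_def)
  finally have energy_i: "energy ?M ?i = b - a" .
  have "norm (LINT t:{a..b}|lborel. h t) \<le> (\<integral>t. norm (?i t *\<^sub>R h t) \<partial>?M)"
    using ab by (simp only: set_integral_subinterval integral_norm_bound)
  also have "\<dots> = L2_inner ?M ?i (\<lambda>t. norm (h t))"
    unfolding L2_inner_def by (intro Bochner_Integration.integral_cong) (auto split: split_indicator)
  also have "\<dots> \<le> sqrt ((b - a) * energy ?M h)"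
    using L2_inner_Cauchy_Schwarz[OF i sq_integrable_norm[OF h]] by (simp add: energy_i energy_norm)
  finally show ?thesis .
qed

lemma AE_zero_if_interval_integrals_zero:
  fixes d :: "real \<Rightarrow> 'a::euclidean_space"
  assumes d: "integrable lborel d" and zero: "\<And>a b. (LINT t:{a..b}|lborel. d t) = 0"
  shows "AE t in lborel. d t = 0"
proof (rule sigma_finite_measure.density_zero[OF sigma_finite_lborel d])
  have d_set: "set_integrable lborel A d" if "A \<in> sets borel" for A
    using integrable_mult_indicator[OF _ d, of A] that by (simp add: set_integrable_def)
  have "(\<lambda>n. LINT t:{- real n..real n}|lborel. d t) \<longlonglongrightarrow> (LINT t:(\<Union>n. {- real n..real n})|lborel. d t)"
    by (intro set_integral_cont_up d_set) (auto simp: incseq_def)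
  moreover have "(\<Union>n. {- real n..real n}) = (UNIV :: real set)"
  proof (intro set_eqI iffI UNIV_I)
    fix x :: real
    obtain n where "\<bar>x\<bar> \<le> real n" using real_arch_simple by blast
    then show "x \<in> (\<Union>n. {- real n..real n})" by (intro UN_I[of n]) auto
  qed
  ultimately have total: "(LINT t:UNIV|lborel. d t) = 0"
    by (simp add: zero LIMSEQ_const_iff)
  fix A :: "real set" assume "A \<in> sets lborel"
  then have "A \<in> sets borel" by simp
  then show "(LINT t:A|lborel. d t) = 0"
  proof (induction rule: borel_set_induct)
    case empty
    then show ?case by (simp add: set_lebesgue_integral_def)
  next
    case (interval a b)
    show ?case by (rule zero)
  next
    case (compl A)
    have "(LINT t:A \<union> - A|lborel. d t) = (LINT t:A|lborel. d t) + (LINT t:- A|lborel. d t)"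
      using compl by (intro set_integral_Un d_set) auto
    then show ?case using compl total by simp
  next
    case (union A)
    have "(LINT t:(\<Union>i. A i)|lborel. d t) = (\<Sum>i. (LINT t:A i|lborel. d t))"
      using union by (intro lebesgue_integral_countable_add d_set) (auto simp: disjoint_family_on_def)
    then show ?case using union by simp
  qed
qed

lemma AE_eq_if_subinterval_integrals_eq:
  fixes f g :: "real \<Rightarrow> 'a::euclidean_space"
  assumes f: "set_integrable lborel {l..u} f" and g: "set_integrable lborel {l..u} g"
    and eq: "\<And>a b. l \<le> a \<Longrightarrow> a \<le> b \<Longrightarrow> b \<le> u \<Longrightarrow> (LINT t:{a..b}|lborel. f t) = (LINT t:{a..b}|lborel. g t)"
  shows "AE t in restrict_space lborel {l..u}. f t = g t"
proof -
  define d where "d t = indicator {l..u} t *\<^sub>R (f t - g t)" for t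
  have "integrable lborel d"
    using set_integral_diff(1)[OF f g] unfolding d_def set_integrable_def .
  moreover have "(LINT t:{a..b}|lborel. d t) = 0" for a b
  proof -
    let ?I = "{max l a..min u b}"
    have "set_integrable lborel ?I f" "set_integrable lborel ?I g"
      by (rule set_integrable_subset[OF f], auto) (rule set_integrable_subset[OF g], auto)
    then have "(LINT t:?I|lborel. f t - g t) = 0"
      using eq[of "max l a" "min u b"]
      by (cases "max l a \<le> min u b") (auto simp: set_lebesgue_integral_def[of _ "{}"])
    moreover have "indicator {a..b} t *\<^sub>R d t = indicator ?I t *\<^sub>R (f t - g t)" for t
      by (auto simp: d_def split: split_indicator)
    ultimately show ?thesis by (simp add: set_lebesgue_integral_def)
  qed
  ultimately have "AE t in lborel. d t = 0"
    by (rule AE_zero_if_interval_integrals_zero)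
  then show ?thesis
    by (subst AE_restrict_space_iff) (auto simp: d_def elim: eventually_mono)
qed

lemma sq_integrable_continuous:
  fixes f :: "real \<Rightarrow> 'a::euclidean_space"
  assumes f: "continuous_on {a..b} f"
  shows "sq_integrable (restrict_space lborel {a..b}) f"
proof -
  obtain B where "\<And>t. t \<in> {a..b} \<Longrightarrow> norm (f t) \<le> B"
    using continuous_on_compact_bound[OF compact_Icc f] by blast
  moreover have "f \<in> borel_measurable (restrict_space lborel {a..b})"
    using borel_measurable_continuous_on_indicator[OF _ f]
    by (subst borel_measurable_restrict_space_iff) auto
  ultimately show ?thesis
    by (intro interval_measure.sq_integrable_bounded(1)[of _ _ _ B]) (auto simp: space_restrict_space)
qed

section \<open>Weak derivatives\<close>

lemma is_wderiv_sq_integrable: "is_wderiv f g \<Longrightarrow> sq_integrable period_measure g"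
  by (auto simp: is_wderiv_def sq_integrable_def integrable_interval_iff measurable_restrict_space1)

lemma is_wderiv_set_integrable: "is_wderiv f g \<Longrightarrow> set_integrable lborel {a..b} g"
  by (simp add: is_wderiv_def)

lemma is_wderiv_integral:
  "is_wderiv f g \<Longrightarrow> a \<le> b \<Longrightarrow> f b - f a = (LINT t:{a..b}|lborel. g t)"
  by (simp add: is_wderiv_def)

lemma is_wderiv_AE_unique:
  assumes "is_wderiv f g" "is_wderiv f h"
  shows "AE t in period_measure. g t = h t"
  using assms
  by (intro AE_eq_if_subinterval_integrals_eq is_wderiv_set_integrable) (auto simp flip: is_wderiv_integral)

lemma H1_loop_wderiv: "H1_loop f \<Longrightarrow> is_wderiv f (wderiv f)"
  unfolding H1_loop_def wderiv_def by (auto intro: someI[of "is_wderiv f"])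

lemma wderiv_AE_eq:
  assumes "is_wderiv f g"
  shows "AE t in period_measure. wderiv f t = g t"
  using is_wderiv_AE_unique[OF someI[of "is_wderiv f", OF assms] assms] by (simp add: wderiv_def)

lemma is_wderiv_Hoelder:
  assumes "is_wderiv f g" "s \<in> {0..2*pi}" "t \<in> {0..2*pi}"
  shows "norm (f s - f t) \<le> sqrt (\<bar>s - t\<bar> * energy period_measure g)"
  using assms(2,3)
proof (induction s t rule: linorder_wlog)
  case (le s t)
  then show ?case
    using norm_set_integral_le[OF is_wderiv_sq_integrable[OF assms(1)], of s t]
      is_wderiv_integral[OF assms(1), of s t] norm_minus_commute[of "f s" "f t"] by simp
next
  case (sym s t)
  then show ?case by (simp add: norm_minus_commute abs_minus_commute)
qed

lemma is_wderiv_norm_diff_le: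
  assumes f: "is_wderiv f g" and "s \<in> {0..2*pi}" "t \<in> {0..2*pi}"
  shows "norm (f s - f t) \<le> (\<integral>t. norm (g t) \<partial>period_measure)"
  using assms(2,3)
proof (induction s t rule: linorder_wlog)
  case (le s t)
  have g: "integrable period_measure g"
    by (simp add: integrable_interval_iff is_wderiv_set_integrable[OF f])
  have "norm (f s - f t) = norm (LINT r:{s..t}|lborel. g r)"
    using is_wderiv_integral[OF f, of s t] le norm_minus_commute[of "f s" "f t"] by simp
  also have "(LINT r:{s..t}|lborel. g r) = (\<integral>r. indicator {s..t} r *\<^sub>R g r \<partial>period_measure)"
    using le by (intro set_integral_subinterval) auto
  also have "norm \<dots> \<le> (\<integral>r. norm (indicator {s..t} r *\<^sub>R g r) \<partial>period_measure)"
    by (rule integral_norm_bound)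
  also have "\<dots> \<le> (\<integral>r. norm (g r) \<partial>period_measure)"
  proof (intro integral_mono integrable_norm integrable_mult_indicator g)
    show "{s..t} \<in> sets period_measure" using le by (auto simp: sets_restrict_space_iff)
  qed (auto split: split_indicator)
  finally show ?case .
next
  case (sym s t)
  then show ?case by (simp add: norm_minus_commute)
qed

lemma is_wderiv_continuous_on:
  assumes f: "is_wderiv f g" shows "continuous_on A f"
proof -
  have Icc: "continuous_on {a..b} f" for a b
  proof (rule continuous_on_eq)
    have "g integrable_on {a..b}"
      by (rule set_borel_integral_eq_integral(1)[OF is_wderiv_set_integrable[OF f]])
    then show "continuous_on {a..b} (\<lambda>t. f a + integral {a..t} g)"
      by (intro continuous_intros indefinite_integral_continuous_1)
    show "f a + integral {a..t} g = f t" if "t \<in> {a..b}" for t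
      using is_wderiv_integral[OF f, of a t] that
        set_borel_integral_eq_integral(2)[OF is_wderiv_set_integrable[OF f], of a t]
      by (simp add: algebra_simps)
  qed
  have "isCont f t" for t
    using continuous_on_interior[OF Icc[of "t - 1" "t + 1"], of t] by simp
  then show ?thesis by (simp add: continuous_at_imp_continuous_on)
qed

lemma sq_integrable_mult_continuous:
  fixes f g :: "real \<Rightarrow> 'a::{euclidean_space, real_normed_field}"
  assumes f: "continuous_on {a..b} f" and g: "sq_integrable (restrict_space lborel {a..b}) g"
  shows "sq_integrable (restrict_space lborel {a..b}) (\<lambda>t. f t * g t)"
proof -
  obtain B where B: "\<And>t. t \<in> {a..b} \<Longrightarrow> norm (f t) \<le> B"
    using continuous_on_compact_bound[OF compact_Icc f] by blast
  show ?thesis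
  proof (rule sq_integrable_bound(1)[OF g, of _ B])
    show "(\<lambda>t. f t * g t) \<in> borel_measurable (restrict_space lborel {a..b})"
      using sq_integrable_measurable[OF sq_integrable_continuous[OF f]] sq_integrable_measurable[OF g]
      by (rule borel_measurable_times)
    show "norm (f t * g t) \<le> B * norm (g t)" if "t \<in> space (restrict_space lborel {a..b})" for t
      using B[of t] that by (simp add: norm_mult mult_right_mono space_restrict_space)
  qed
qed

lemma is_wderiv_add:
  assumes "is_wderiv f f'" "is_wderiv g g'"
  shows "is_wderiv (\<lambda>t. f t + g t) (\<lambda>t. f' t + g' t)"
proof -
  have "sq_integrable period_measure (\<lambda>t. f' t + g' t)"
    by (intro sq_integrable_add is_wderiv_sq_integrable[OF assms(1)] is_wderiv_sq_integrable[OF assms(2)])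
  moreover have "f b + g b - (f a + g a) = (LINT t:{a..b}|lborel. f' t + g' t)" if "a \<le> b" for a b
  proof -
    have "(LINT t:{a..b}|lborel. f' t + g' t) = (LINT t:{a..b}|lborel. f' t) + (LINT t:{a..b}|lborel. g' t)"
      using assms by (intro set_integral_add(2) is_wderiv_set_integrable)
    then show ?thesis
      using is_wderiv_integral[OF assms(1) that] is_wderiv_integral[OF assms(2) that]
      by (simp add: algebra_simps)
  qed
  ultimately show ?thesis
    using assms
    by (auto simp: is_wderiv_def sq_integrable_def integrable_interval_iff intro!: set_integral_add(1))
qed

lemma is_wderiv_bounded_linear:
  assumes L: "bounded_linear L" and fg: "is_wderiv f g"
  shows "is_wderiv (\<lambda>t. L (f t)) (\<lambda>t. L (g t))"
proof -
  interpret bounded_linear L by fact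
  have int: "integrable lborel (\<lambda>t. indicator {a..b} t *\<^sub>R g t)" for a b
    using is_wderiv_set_integrable[OF fg] by (simp add: set_integrable_def)
  have "(\<lambda>t. L (g t)) \<in> borel_measurable lborel"
    using fg
    by (intro borel_measurable_continuous_on[OF linear_continuous_on[OF L]]) (simp add: is_wderiv_def)
  moreover have "set_integrable lborel {a..b} (\<lambda>t. L (g t))" for a b
    using integrable_bounded_linear[OF L int] by (simp add: set_integrable_def scaleR)
  moreover have "L (f b) - L (f a) = (LINT t:{a..b}|lborel. L (g t))" if "a \<le> b" for a b
    using integral_bounded_linear[OF L int] is_wderiv_integral[OF fg that]
    by (simp add: set_lebesgue_integral_def scaleR flip: diff)
  moreover have "set_integrable lborel {0..2*pi} (\<lambda>t. (norm (L (g t)))\<^sup>2)"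
    using sq_integrable_bounded_linear[OF L is_wderiv_sq_integrable[OF fg]]
    by (simp add: sq_integrable_def integrable_interval_iff)
  ultimately show ?thesis unfolding is_wderiv_def by blast
qed

lemma is_wderiv_C1:
  fixes f :: "real \<Rightarrow> 'a::euclidean_space"
  assumes f: "\<And>t. (f has_vector_derivative f' t) (at t)" and f': "continuous_on UNIV f'"
  shows "is_wderiv f f'"
  unfolding is_wderiv_def
proof (intro conjI allI impI)
  show "f' \<in> borel_measurable lborel"
    using borel_measurable_continuous_onI[OF f'] by simp
  show "set_integrable lborel {a..b} f'" for a b
    using f' continuous_on_subset by (intro borel_integrable_atLeastAtMost') blast
  show "set_integrable lborel {0..2*pi} (\<lambda>t. (norm (f' t))\<^sup>2)"
    using continuous_on_subset[OF f'] by (intro borel_integrable_atLeastAtMost' continuous_intros) auto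
  show "f b - f a = (LINT t:{a..b}|lborel. f' t)" if "a \<le> b" for a b
    unfolding set_lebesgue_integral_def
    using f continuous_on_subset[OF f'] that
    by (intro integral_FTC_Icc[symmetric]) (auto intro: has_vector_derivative_at_within)
qed

lemma product_rule_defect_le:
  fixes f g :: "real \<Rightarrow> 'a::{euclidean_space, real_normed_field}"
  assumes f: "is_wderiv f f'" and g: "is_wderiv g g'" and "a \<le> b"
    and osc_f: "\<And>s t. s \<in> {a..b} \<Longrightarrow> t \<in> {a..b} \<Longrightarrow> norm (f s - f t) \<le> \<epsilon>"
    and osc_g: "\<And>s t. s \<in> {a..b} \<Longrightarrow> t \<in> {a..b} \<Longrightarrow> norm (g s - g t) \<le> \<epsilon>"
  shows "norm (f b * g b - f a * g a - (LINT t:{a..b}|lborel. f t * g' t + g t * f' t))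
    \<le> \<epsilon> * (LINT t:{a..b}|lborel. norm (f' t) + norm (g' t))"
proof -
  note int = is_wderiv_set_integrable[OF f, of a b] is_wderiv_set_integrable[OF g, of a b]
  note cont = is_wderiv_continuous_on[OF f] is_wderiv_continuous_on[OF g]
  note int_mult = set_integrable_mult_continuous[OF _ int(1)] set_integrable_mult_continuous[OF _ int(2)]
  define e where "e t = (f b - f t) * g' t + (g a - g t) * f' t" for t
  have e_int: "set_integrable lborel {a..b} e"
    unfolding e_def by (intro set_integral_add(1) int_mult continuous_intros cont)
  have norm_int: "set_integrable lborel {a..b} (\<lambda>t. norm (f' t) + norm (g' t))"
    by (intro set_integral_add(1) set_integrable_norm int)
  have "f b * g b - f a * g a = f b * (LINT t:{a..b}|lborel. g' t) + g a * (LINT t:{a..b}|lborel. f' t)"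
    using is_wderiv_integral[OF f \<open>a \<le> b\<close>] is_wderiv_integral[OF g \<open>a \<le> b\<close>]
    by (simp flip: is_wderiv_integral[OF f \<open>a \<le> b\<close>] add: algebra_simps)
  also have "\<dots> = (LINT t:{a..b}|lborel. f b * g' t + g a * f' t)"
    using int by simp
  also have "\<dots> = (LINT t:{a..b}|lborel. (f t * g' t + g t * f' t) + e t)"
    by (simp add: e_def algebra_simps)
  also have "\<dots> = (LINT t:{a..b}|lborel. f t * g' t + g t * f' t) + (LINT t:{a..b}|lborel. e t)"
    by (intro set_integral_add(2) set_integral_add(1) int_mult cont e_int)
  finally have "norm (f b * g b - f a * g a - (LINT t:{a..b}|lborel. f t * g' t + g t * f' t))
      = norm (LINT t:{a..b}|lborel. e t)" by simp
  also have "\<dots> \<le> (LINT t:{a..b}|lborel. norm (e t))"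
    by (rule set_integral_norm_bound[OF e_int])
  also have "\<dots> \<le> (LINT t:{a..b}|lborel. \<epsilon> * (norm (f' t) + norm (g' t)))"
  proof (intro set_integral_mono set_integrable_norm e_int set_integrable_mult_right norm_int)
    fix t assume t: "t \<in> {a..b}"
    have "norm (e t) \<le> norm (f b - f t) * norm (g' t) + norm (g a - g t) * norm (f' t)"
      unfolding e_def by (rule order_trans[OF norm_triangle_ineq]) (simp add: norm_mult)
    also have "\<dots> \<le> \<epsilon> * norm (g' t) + \<epsilon> * norm (f' t)"
      using osc_f osc_g t \<open>a \<le> b\<close> by (intro add_mono mult_right_mono) auto
    finally show "norm (e t) \<le> \<epsilon> * (norm (f' t) + norm (g' t))" by (simp add: algebra_simps)
  qed
  finally show ?thesis by simp
qed

lemma continuous_on_Icc_small_oscillation: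
  fixes f :: "real \<Rightarrow> 'a::real_normed_vector"
  assumes "continuous_on UNIV f" and "0 < \<epsilon>"
  obtains d where "0 < d" "\<And>a b s t. a \<le> x \<Longrightarrow> x \<le> b \<Longrightarrow> b - a < d \<Longrightarrow>
    s \<in> {a..b} \<Longrightarrow> t \<in> {a..b} \<Longrightarrow> norm (f s - f t) \<le> \<epsilon>"
proof -
  have "uniformly_continuous_on {x-1..x+1} f"
    by (intro compact_uniformly_continuous continuous_on_subset[OF assms(1)]) auto
  then obtain d where d: "0 < d"
    "\<And>s t. s \<in> {x-1..x+1} \<Longrightarrow> t \<in> {x-1..x+1} \<Longrightarrow> dist s t < d \<Longrightarrow> dist (f s) (f t) < \<epsilon>"
    using \<open>0 < \<epsilon>\<close> unfolding uniformly_continuous_on_def by metis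
  show ?thesis
  proof (rule that[of "min d 1"])
    fix a b s t assume "a \<le> x" "x \<le> b" "b - a < min d 1" "s \<in> {a..b}" "t \<in> {a..b}"
    then show "norm (f s - f t) \<le> \<epsilon>"
      using d(2)[of s t] by (force simp: dist_real_def dist_norm)
  qed (use d(1) in simp)
qed

lemma product_rule_defect_locally_le:
  fixes f g :: "real \<Rightarrow> 'a::{euclidean_space, real_normed_field}"
  assumes f: "is_wderiv f f'" and g: "is_wderiv g g'" and "0 < \<epsilon>"
  obtains d where "0 < d" "\<And>a b. a \<le> x \<Longrightarrow> x \<le> b \<Longrightarrow> b - a < d \<Longrightarrow>
    norm (f b * g b - f a * g a - (LINT t:{a..b}|lborel. f t * g' t + g t * f' t))
      \<le> \<epsilon> * (LINT t:{a..b}|lborel. norm (f' t) + norm (g' t))"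
proof -
  obtain d1 where d1: "0 < d1" "\<And>a b s t. a \<le> x \<Longrightarrow> x \<le> b \<Longrightarrow> b - a < d1 \<Longrightarrow>
      s \<in> {a..b} \<Longrightarrow> t \<in> {a..b} \<Longrightarrow> norm (f s - f t) \<le> \<epsilon>"
    using continuous_on_Icc_small_oscillation[OF is_wderiv_continuous_on[OF f] \<open>0 < \<epsilon>\<close>] by metis
  obtain d2 where d2: "0 < d2" "\<And>a b s t. a \<le> x \<Longrightarrow> x \<le> b \<Longrightarrow> b - a < d2 \<Longrightarrow>
      s \<in> {a..b} \<Longrightarrow> t \<in> {a..b} \<Longrightarrow> norm (g s - g t) \<le> \<epsilon>"
    using continuous_on_Icc_small_oscillation[OF is_wderiv_continuous_on[OF g] \<open>0 < \<epsilon>\<close>] by metis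
  show ?thesis
  proof (rule that[of "min d1 d2"])
    fix a b assume "a \<le> x" "x \<le> b" "b - a < min d1 d2"
    then show "norm (f b * g b - f a * g a - (LINT t:{a..b}|lborel. f t * g' t + g t * f' t))
        \<le> \<epsilon> * (LINT t:{a..b}|lborel. norm (f' t) + norm (g' t))"
      using d1(2)[of a b] d2(2)[of a b] by (intro product_rule_defect_le[OF f g]) auto
  qed (use d1(1) d2(1) in simp)
qed

text \<open>The defect in the product rule is additive and, by continuity, of smaller order than the
  integral of \<open>\<bar>f'\<bar> + \<bar>g'\<bar>\<close>; hence it vanishes.\<close>

lemma is_wderiv_product_integral:
  fixes f g :: "real \<Rightarrow> 'a::{euclidean_space, real_normed_field}"
  assumes f: "is_wderiv f f'" and g: "is_wderiv g g'" and "a \<le> b"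
  shows "f b * g b - f a * g a = (LINT t:{a..b}|lborel. f t * g' t + g t * f' t)"
proof -
  note int_f = is_wderiv_set_integrable[OF f] and int_g = is_wderiv_set_integrable[OF g]
  note cont = is_wderiv_continuous_on[OF f] is_wderiv_continuous_on[OF g]
  define D where "D a b = f b * g b - f a * g a - (LINT t:{a..b}|lborel. f t * g' t + g t * f' t)" for a b
  define V where "V a b = (LINT t:{a..b}|lborel. norm (f' t) + norm (g' t))" for a b
  have D_add: "D a c = D a b + D b c" if "a \<le> b" "b \<le> c" for a b c
    unfolding D_def using that
    by (subst set_integral_Icc_combine(2)[of a b c])
      (auto intro!: set_integral_add(1) set_integrable_mult_continuous int_f int_g cont)
  have V_add: "V a c = V a b + V b c" if "a \<le> b" "b \<le> c" for a b c
    unfolding V_def using that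
    by (intro set_integral_Icc_combine(2)) (auto intro!: set_integral_add(1) set_integrable_norm int_f int_g)
  have D_le: "norm (D a b) \<le> \<epsilon> * V a b" if "0 < \<epsilon>" for \<epsilon>
    using \<open>a \<le> b\<close>
  proof (induction rule: Bolzano)
    case (trans a b c)
    then show ?case
      using norm_triangle_ineq[of "D a b" "D b c"] by (simp add: D_add[of a b c] V_add[of a b c] distrib_left)
  next
    case (local x)
    show ?case
      unfolding D_def V_def by (rule product_rule_defect_locally_le[OF f g that, of x]) blast
  qed
  have "norm (D a b) \<le> 0 + \<epsilon>" if "0 < \<epsilon>" for \<epsilon>
  proof -
    have "0 \<le> V a b" by (simp add: V_def set_lebesgue_integral_def)
    then have "\<epsilon> / (V a b + 1) * V a b \<le> \<epsilon>" using that by (simp add: field_simps)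
    moreover have "norm (D a b) \<le> \<epsilon> / (V a b + 1) * V a b"
      using that \<open>0 \<le> V a b\<close> by (intro D_le) (simp add: add_nonneg_pos)
    ultimately show ?thesis by simp
  qed
  then have "norm (D a b) \<le> 0" by (rule field_le_epsilon)
  then show ?thesis by (simp add: D_def)
qed

lemma is_wderiv_mult:
  fixes f g :: "real \<Rightarrow> 'a::{euclidean_space, real_normed_field}"
  assumes f: "is_wderiv f f'" and g: "is_wderiv g g'"
  shows "is_wderiv (\<lambda>t. f t * g t) (\<lambda>t. f t * g' t + g t * f' t)"
  unfolding is_wderiv_def
proof (intro conjI allI impI)
  note cont = is_wderiv_continuous_on[OF f] is_wderiv_continuous_on[OF g]
  have [measurable]: "f \<in> borel_measurable lborel" "g \<in> borel_measurable lborel"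
    using borel_measurable_continuous_onI[OF cont(1)] borel_measurable_continuous_onI[OF cont(2)] by simp_all
  have [measurable]: "f' \<in> borel_measurable lborel" "g' \<in> borel_measurable lborel"
    using f g by (simp_all add: is_wderiv_def)
  show "(\<lambda>t. f t * g' t + g t * f' t) \<in> borel_measurable lborel" by measurable
  show "set_integrable lborel {a..b} (\<lambda>t. f t * g' t + g t * f' t)" for a b
    by (intro set_integral_add(1) set_integrable_mult_continuous cont is_wderiv_set_integrable[OF f]
        is_wderiv_set_integrable[OF g])
  have "sq_integrable period_measure (\<lambda>t. f t * g' t + g t * f' t)"
    by (intro sq_integrable_add sq_integrable_mult_continuous cont is_wderiv_sq_integrable[OF f]
        is_wderiv_sq_integrable[OF g])
  then show "set_integrable lborel {0..2*pi} (\<lambda>t. (norm (f t * g' t + g t * f' t))\<^sup>2)"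
    by (simp add: sq_integrable_def integrable_interval_iff)
  show "f b * g b - f a * g a = (LINT t:{a..b}|lborel. f t * g' t + g t * f' t)" if "a \<le> b" for a b
    by (rule is_wderiv_product_integral[OF f g that])
qed

section \<open>Periodic functions with a weak derivative\<close>

lemma periodic_rmod:
  fixes f :: "real \<Rightarrow> 'a"
  assumes "\<And>t. f (t + p) = f t" and "0 < p"
  shows "f (t rmod p) = f t"
proof -
  interpret periodic_fun_simple f p by unfold_locales (rule assms(1))
  show ?thesis
    using minus_of_int[of t "\<lfloor>t / p\<rfloor>"] \<open>0 < p\<close> by (simp add: rmod_def mult.commute)
qed

lemma rmod_period_in: "t rmod (2*pi) \<in> {0..2*pi}"
  using rmod_nonneg[of "2*pi" t] rmod_le[of "2*pi" t] by simp

lemma H1_loop_rmod: "H1_loop f \<Longrightarrow> f (t rmod (2*pi)) = f t"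
  by (rule periodic_rmod) (simp_all add: H1_loop_def)

definition primitive_on :: "(real \<Rightarrow> 'a::euclidean_space) \<Rightarrow> (real \<Rightarrow> 'a) \<Rightarrow> real \<Rightarrow> real \<Rightarrow> bool" where
  "primitive_on F g a b \<longleftrightarrow> set_integrable lborel {a..b} g \<and> F b - F a = (LINT t:{a..b}|lborel. g t)"

lemma primitive_on_trans:
  "primitive_on F g a b \<Longrightarrow> primitive_on F g b c \<Longrightarrow> a \<le> b \<Longrightarrow> b \<le> c \<Longrightarrow> primitive_on F g a c"
  by (auto simp: primitive_on_def set_integral_Icc_combine[of a b c] algebra_simps)

lemma primitive_on_translate:
  fixes F g :: "real \<Rightarrow> 'a::euclidean_space"
  assumes "primitive_on F g (a - c) (b - c)"
  shows "primitive_on (\<lambda>t. F (t - c)) (\<lambda>t. g (t - c)) a b"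
proof -
  define J where "J t = indicator {a - c..b - c} t *\<^sub>R g t" for t
  have J: "J (- c + 1 * t) = indicator {a..b} t *\<^sub>R g (t - c)" for t
    by (auto simp: J_def split: split_indicator)
  have "integrable lborel (\<lambda>t. J (- c + 1 * t))"
    using assms
    by (subst lborel_integrable_real_affine_iff) (auto simp: primitive_on_def set_integrable_def J_def[abs_def])
  moreover have "(\<integral>t. J (- c + 1 * t) \<partial>lborel) = (\<integral>t. J t \<partial>lborel)"
    using lborel_integral_real_affine[of 1 J "- c"] by simp
  ultimately have "integrable lborel (\<lambda>t. indicator {a..b} t *\<^sub>R g (t - c))"
    and "(\<integral>t. indicator {a..b} t *\<^sub>R g (t - c) \<partial>lborel) = (\<integral>t. J t \<partial>lborel)"
    by (simp_all only: J)
  then show ?thesis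
    using assms by (simp add: primitive_on_def set_integrable_def set_lebesgue_integral_def J_def)
qed

lemma primitive_on_cong_AE:
  assumes F: "primitive_on F g a b" and eq: "AE t in lborel. t \<in> {a..b} \<longrightarrow> g t = h t"
    and h: "h \<in> borel_measurable borel"
  shows "primitive_on F h a b"
proof -
  have ae: "AE t in lborel. indicator {a..b} t *\<^sub>R g t = indicator {a..b} t *\<^sub>R h t"
    using eq by eventually_elim (auto split: split_indicator)
  have g_int: "integrable lborel (\<lambda>t. indicator {a..b} t *\<^sub>R g t)"
    using F by (simp add: primitive_on_def set_integrable_def)
  have h_meas: "(\<lambda>t. indicator {a..b} t *\<^sub>R h t) \<in> borel_measurable lborel"
    using h by simp
  show ?thesis
    using F g_int integrable_cong_AE[OF borel_measurable_integrable[OF g_int] h_meas ae]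
      integral_cong_AE[OF borel_measurable_integrable[OF g_int] h_meas ae]
    by (simp add: primitive_on_def set_integrable_def set_lebesgue_integral_def)
qed

lemma interval_property_from_cells:
  fixes P :: "real \<Rightarrow> real \<Rightarrow> bool"
  assumes "a \<le> b" "0 < p"
    and trans: "\<And>a b c. P a b \<Longrightarrow> P b c \<Longrightarrow> a \<le> b \<Longrightarrow> b \<le> c \<Longrightarrow> P a c"
    and cell: "\<And>a b (k::int). p * of_int k \<le> a \<Longrightarrow> a \<le> b \<Longrightarrow> b \<le> p * (of_int k + 1) \<Longrightarrow> P a b"
  shows "P a b"
  using \<open>a \<le> b\<close>
proof (induction rule: Bolzano)
  case (local x)
  have "P a b" if "a \<le> b" "b - a < p" for a b
  proof -
    define k where "k = \<lfloor>b / p\<rfloor>"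
    have k: "p * of_int k \<le> b" "b < p * (of_int k + 1)"
      using \<open>0 < p\<close> floor_divide_lower[of p b] floor_divide_upper[of p b] by (auto simp: k_def mult.commute)
    show ?thesis
    proof (cases "p * of_int k \<le> a")
      case True
      then show ?thesis using k that by (intro cell[of k]) auto
    next
      case False
      have "P a (p * of_int k)"
        using False k that by (intro cell[of "k - 1"]) (auto simp: algebra_simps)
      moreover have "P (p * of_int k) b"
        using k by (intro cell[of k]) auto
      ultimately show ?thesis using False k by (auto intro: trans)
    qed
  qed
  then show ?case using \<open>0 < p\<close> by (intro exI[of _ p]) auto
qed (rule trans)

definition has_L2_derivative :: "(real \<Rightarrow> 'a::euclidean_space) \<Rightarrow> (real \<Rightarrow> 'a) \<Rightarrow> bool" where
  "has_L2_derivative F G \<longleftrightarrow> sq_integrable period_measure G \<and>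
     (\<forall>a b. 0 \<le> a \<longrightarrow> a \<le> b \<longrightarrow> b \<le> 2*pi \<longrightarrow> F b - F a = (LINT t:{a..b}|lborel. G t))"

lemma has_L2_derivative_sq_integrable: "has_L2_derivative F G \<Longrightarrow> sq_integrable period_measure G"
  by (simp add: has_L2_derivative_def)

lemma has_L2_derivative_set_integrable: "has_L2_derivative F G \<Longrightarrow> set_integrable lborel {0..2*pi} G"
  using interval_measure.sq_integrable_imp_integrable
  by (auto simp: has_L2_derivative_def simp flip: integrable_interval_iff)

lemma has_L2_derivative_AE_unique:
  assumes "has_L2_derivative F G" "has_L2_derivative F H"
  shows "AE t in period_measure. G t = H t"
  using assms has_L2_derivative_set_integrable[OF assms(1)] has_L2_derivative_set_integrable[OF assms(2)]
  by (intro AE_eq_if_subinterval_integrals_eq) (auto simp: has_L2_derivative_def)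

text \<open>The indicator is constantly 1; it makes the extension Borel although \<open>G\<close> is only measurable on the period.\<close>

definition periodic_extension :: "(real \<Rightarrow> 'a::real_vector) \<Rightarrow> real \<Rightarrow> 'a" where
  "periodic_extension G t = indicator {0..2*pi} (t rmod (2*pi)) *\<^sub>R G (t rmod (2*pi))"

lemma borel_measurable_periodic_extension:
  fixes G :: "real \<Rightarrow> 'a::euclidean_space"
  assumes "G \<in> borel_measurable period_measure"
  shows "periodic_extension G \<in> borel_measurable borel"
proof -
  have [measurable]: "(\<lambda>t. indicator {0..2*pi} t *\<^sub>R G t) \<in> borel_measurable borel"
    using assms by (subst (asm) borel_measurable_restrict_space_iff) auto
  show ?thesis
    unfolding periodic_extension_def[abs_def] rmod_def by measurable
qed

lemma periodic_extension_eq: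
  assumes "2*pi * of_int k \<le> t" "t < 2*pi * (of_int k + 1)"
  shows "periodic_extension G t = G (t - 2*pi * of_int k)"
proof -
  have "t rmod (2*pi) = t - 2*pi * of_int k"
    using assms by (intro rmod_unique[of _ _ _ k]) (auto simp: algebra_simps)
  moreover have "t - 2*pi * of_int k \<in> {0..2*pi}" using assms by (simp add: algebra_simps)
  ultimately show ?thesis by (simp add: periodic_extension_def)
qed

lemma periodic_extension_AE_eq: "AE t in period_measure. periodic_extension G t = G t"
  using AE_lborel_singleton[of "2*pi"]
  by (subst AE_restrict_space_iff)
    (auto elim!: eventually_mono intro: periodic_extension_eq[of 0, simplified])

lemma primitive_on_periodic_extension:
  assumes per: "\<And>t. F (t + 2*pi) = F t" and G: "has_L2_derivative F G" and "a \<le> b"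
  shows "primitive_on F (periodic_extension G) a b"
proof (rule interval_property_from_cells[OF \<open>a \<le> b\<close>, of "2*pi"])
  interpret periodic_fun_simple F "2*pi" by unfold_locales (rule per)
  fix a b and k :: int
  assume ab: "2*pi * of_int k \<le> a" "a \<le> b" "b \<le> 2*pi * (of_int k + 1)"
  let ?s = "2*pi * of_int k"
  have "set_integrable lborel {a - ?s..b - ?s} G"
    using ab
    by (intro set_integrable_subset[OF has_L2_derivative_set_integrable[OF G]]) (auto simp: algebra_simps)
  then have "primitive_on F G (a - ?s) (b - ?s)"
    using G ab by (simp add: primitive_on_def has_L2_derivative_def algebra_simps)
  then have "primitive_on F (\<lambda>t. G (t - ?s)) a b"
    using primitive_on_translate[of F G a ?s b] minus_of_int[of _ k] by (simp add: mult.commute)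
  moreover have "AE t in lborel. t \<in> {a..b} \<longrightarrow> G (t - ?s) = periodic_extension G t"
    using AE_lborel_singleton[of "2*pi * (of_int k + 1)"]
  proof eventually_elim
    case (elim t)
    then show ?case using ab periodic_extension_eq[of k t G] by auto
  qed
  ultimately show "primitive_on F (periodic_extension G) a b"
    by (rule primitive_on_cong_AE)
      (rule borel_measurable_periodic_extension[OF sq_integrable_measurable[OF
            has_L2_derivative_sq_integrable[OF G]]])
qed (auto intro: primitive_on_trans)

lemma is_wderiv_periodic_extension:
  assumes per: "\<And>t. F (t + 2*pi) = F t" and G: "has_L2_derivative F G"
  shows "is_wderiv F (periodic_extension G)"
  unfolding is_wderiv_def
proof (intro conjI allI impI)
  let ?g = "periodic_extension G"
  note G_sq = has_L2_derivative_sq_integrable[OF G]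
  have g_meas: "?g \<in> borel_measurable borel"
    by (rule borel_measurable_periodic_extension[OF sq_integrable_measurable[OF G_sq]])
  then show "?g \<in> borel_measurable lborel" by simp
  show "F b - F a = (LINT t:{a..b}|lborel. ?g t)" if "a \<le> b" for a b
    using primitive_on_periodic_extension[OF per G that] by (simp add: primitive_on_def)
  show "set_integrable lborel {a..b} ?g" for a b
    using primitive_on_periodic_extension[OF per G, of a b]
    by (cases "a \<le> b") (auto simp: primitive_on_def set_integrable_def)
  have "integrable period_measure (\<lambda>t. (norm (?g t))\<^sup>2) \<longleftrightarrow> integrable period_measure (\<lambda>t. (norm (G t))\<^sup>2)"
    using periodic_extension_AE_eq[of G] sq_integrable_measurable[OF G_sq]
      measurable_restrict_space1[of ?g lborel borel "{0..2*pi}"] g_meas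
    by (intro integrable_cong_AE) (auto elim: eventually_mono)
  then show "set_integrable lborel {0..2*pi} (\<lambda>t. (norm (?g t))\<^sup>2)"
    using sq_integrable_norm_square[OF G_sq] by (simp add: integrable_interval_iff)
qed

section \<open>Weak limits of \<open>H\<^sup>1\<close> loops\<close>

lemma LIMSEQ_if_unique_subseq_limit:
  fixes X :: "nat \<Rightarrow> 'a::heine_borel"
  assumes "bounded (range X)"
    and unique: "\<And>r l. strict_mono (r :: nat \<Rightarrow> nat) \<Longrightarrow> (\<lambda>n. X (r n)) \<longlonglongrightarrow> l \<Longrightarrow> l = L"
  shows "X \<longlonglongrightarrow> L"
proof (rule ccontr)
  assume "\<not> X \<longlonglongrightarrow> L"
  then obtain e where e: "0 < e" "\<And>k. \<exists>n\<ge>k. e \<le> dist (X n) L"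
    unfolding lim_sequentially by (meson not_le)
  then have "infinite {n. e \<le> dist (X n) L}"
    by (auto simp: infinite_nat_iff_unbounded_le)
  then obtain r :: "nat \<Rightarrow> nat" where r: "strict_mono r" "\<And>n. e \<le> dist (X (r n)) L"
    using infinite_enumerate by blast
  have "bounded (range (\<lambda>n. X (r n)))"
    using assms(1) by (rule bounded_subset) auto
  then obtain l s where s: "strict_mono (s :: nat \<Rightarrow> nat)" "(\<lambda>n. X (r (s n))) \<longlonglongrightarrow> l"
    using bounded_imp_convergent_subsequence[of "\<lambda>n. X (r n)"] by (auto simp: o_def)
  moreover have "l = L"
    using unique[OF strict_mono_o[OF r(1) s(1)]] s(2) by (simp add: o_def)
  ultimately obtain n where "dist (X (r (s n))) L < e"
    using e(1) unfolding lim_sequentially by blast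
  with r(2)[of "s n"] show False by simp
qed

lemma bounded_L2_inner:
  assumes g: "\<And>n. sq_integrable M (g n)" and bound: "\<And>n. energy M (g n) \<le> C"
    and \<psi>: "sq_integrable M \<psi>"
  shows "bounded (range (\<lambda>n. L2_inner M (g n) \<psi>))"
proof -
  have "\<bar>L2_inner M (g n) \<psi>\<bar> \<le> sqrt (C * energy M \<psi>)" for n
    by (rule order_trans[OF L2_inner_Cauchy_Schwarz[OF g \<psi>]]) (simp add: bound mult_right_mono energy_nonneg)
  then show ?thesis by (auto simp: bounded_iff)
qed

lemma L2_inner_indicator:
  fixes u :: "real \<Rightarrow> 'a::euclidean_space"
  assumes u: "sq_integrable (restrict_space lborel {l..r}) u" and ab: "l \<le> a" "b \<le> r"
  shows "L2_inner (restrict_space lborel {l..r}) u (\<lambda>t. indicator {a..b} t *\<^sub>R e)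
    = (LINT t:{a..b}|lborel. u t) \<bullet> e"
proof -
  have "integrable (restrict_space lborel {l..r}) (\<lambda>t. indicator {a..b} t *\<^sub>R u t)"
    using ab by (intro integrable_mult_indicator interval_measure.sq_integrable_imp_integrable[OF u])
      (auto simp: sets_restrict_space_iff)
  then show ?thesis
    using ab by (simp add: L2_inner_def set_integral_subinterval[of l _ _ r] flip: integral_inner_left)
qed

lemma weak_derivative_limit_exists:
  fixes f g :: "nat \<Rightarrow> real \<Rightarrow> 'a::euclidean_space"
  assumes fg: "\<And>n. is_wderiv (f n) (g n)" and bound: "\<And>n. energy period_measure (g n) \<le> C"
    and lim: "\<And>t. (\<lambda>n. f n t) \<longlonglongrightarrow> F t"
  obtains G where "has_L2_derivative F G"
    "\<And>\<psi> \<alpha>. sq_integrable period_measure \<psi> \<Longrightarrow> (\<lambda>n. L2_inner period_measure (g n) \<psi>) \<longlonglongrightarrow> \<alpha> \<Longrightarrow>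
      L2_inner period_measure G \<psi> = \<alpha>"
proof -
  note g = is_wderiv_sq_integrable[OF fg]
  obtain G where G: "sq_integrable period_measure G"
    and G_lim: "\<And>\<psi> \<alpha>. sq_integrable period_measure \<psi> \<Longrightarrow> (\<lambda>n. L2_inner period_measure (g n) \<psi>) \<longlonglongrightarrow> \<alpha> \<Longrightarrow>
      L2_inner period_measure G \<psi> = \<alpha>"
    using interval_measure.bounded_energy_weak_limit[of 0 "2*pi" g C] g bound by blast
  have "F b - F a = (LINT t:{a..b}|lborel. G t)" if ab: "0 \<le> a" "a \<le> b" "b \<le> 2*pi" for a b
  proof (rule euclidean_eqI)
    fix e :: 'a
    let ?\<psi> = "\<lambda>t. indicator {a..b} t *\<^sub>R e"
    have \<psi>: "sq_integrable period_measure ?\<psi>"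
      using ab by (intro sq_integrable_indicator)
    have "(\<lambda>n. (f n b - f n a) \<bullet> e) \<longlonglongrightarrow> (F b - F a) \<bullet> e"
      by (intro tendsto_intros lim)
    then have "(\<lambda>n. L2_inner period_measure (g n) ?\<psi>) \<longlonglongrightarrow> (F b - F a) \<bullet> e"
      using ab by (simp add: L2_inner_indicator g is_wderiv_integral[OF fg])
    then have "L2_inner period_measure G ?\<psi> = (F b - F a) \<bullet> e"
      by (rule G_lim[OF \<psi>])
    then show "(F b - F a) \<bullet> e = (LINT t:{a..b}|lborel. G t) \<bullet> e"
      using ab by (simp add: L2_inner_indicator G)
  qed
  with G have "has_L2_derivative F G" by (simp add: has_L2_derivative_def)
  then show ?thesis using G_lim by (rule that)
qed

lemma weak_derivative_limit:
  fixes f g :: "nat \<Rightarrow> real \<Rightarrow> 'a::euclidean_space"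
  assumes fg: "\<And>n. is_wderiv (f n) (g n)" and bound: "\<And>n. energy period_measure (g n) \<le> C"
    and lim: "\<And>t. (\<lambda>n. f n t) \<longlonglongrightarrow> F t"
  obtains G where "has_L2_derivative F G"
    "\<And>\<psi>. sq_integrable period_measure \<psi> \<Longrightarrow>
      (\<lambda>n. L2_inner period_measure (g n) \<psi>) \<longlonglongrightarrow> L2_inner period_measure G \<psi>"
proof -
  obtain G where G: "has_L2_derivative F G"
    by (rule weak_derivative_limit_exists[OF fg bound lim]) (rule that)
  have "(\<lambda>n. L2_inner period_measure (g n) \<psi>) \<longlonglongrightarrow> L2_inner period_measure G \<psi>"
    if \<psi>: "sq_integrable period_measure \<psi>" for \<psi>
  proof (rule LIMSEQ_if_unique_subseq_limit)
    show "bounded (range (\<lambda>n. L2_inner period_measure (g n) \<psi>))"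
      by (rule bounded_L2_inner[OF is_wderiv_sq_integrable[OF fg] bound \<psi>])
    fix r :: "nat \<Rightarrow> nat" and \<alpha>
    assume r: "strict_mono r" and \<alpha>: "(\<lambda>n. L2_inner period_measure (g (r n)) \<psi>) \<longlonglongrightarrow> \<alpha>"
    have lim_r: "(\<lambda>n. f (r n) t) \<longlonglongrightarrow> F t" for t
      using LIMSEQ_subseq_LIMSEQ[OF lim r] by (simp add: o_def)
    obtain G' where G': "has_L2_derivative F G'"
      and G'_lim: "\<And>\<psi> \<alpha>. sq_integrable period_measure \<psi> \<Longrightarrow>
        (\<lambda>n. L2_inner period_measure (g (r n)) \<psi>) \<longlonglongrightarrow> \<alpha> \<Longrightarrow> L2_inner period_measure G' \<psi> = \<alpha>"
      by (rule weak_derivative_limit_exists[OF fg bound lim_r]) (rule that)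
    then show "\<alpha> = L2_inner period_measure G \<psi>"
      using L2_inner_cong_AE[OF has_L2_derivative_sq_integrable[OF G'] has_L2_derivative_sq_integrable[OF G] \<psi>
          has_L2_derivative_AE_unique[OF G' G]] G'_lim[OF \<psi> \<alpha>] by simp
  qed
  with G show ?thesis by (rule that)
qed

text \<open>Pointwise convergence with bounded energies of the derivatives is weak convergence in \<open>H\<^sup>1\<close>.\<close>

definition H1_weak_limit :: "(nat \<Rightarrow> real \<Rightarrow> 'a::euclidean_space) \<Rightarrow> (real \<Rightarrow> 'a) \<Rightarrow> bool" where
  "H1_weak_limit f F \<longleftrightarrow> (\<forall>n. H1_loop (f n)) \<and> (\<exists>C. \<forall>n. energy period_measure (wderiv (f n)) \<le> C)
     \<and> (\<forall>t. (\<lambda>n. f n t) \<longlonglongrightarrow> F t)"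

lemma H1_weak_limit_seq: "H1_weak_limit f F \<Longrightarrow> H1_loop (f n)"
  by (simp add: H1_weak_limit_def)

lemma H1_weak_limit_pointwise: "H1_weak_limit f F \<Longrightarrow> (\<lambda>n. f n t) \<longlonglongrightarrow> F t"
  by (simp add: H1_weak_limit_def)

lemma sq_integrable_wderiv: "H1_loop f \<Longrightarrow> sq_integrable period_measure (wderiv f)"
  using H1_loop_wderiv is_wderiv_sq_integrable by blast

lemma H1_loop_continuous_on: "H1_loop f \<Longrightarrow> continuous_on A f"
  using H1_loop_wderiv is_wderiv_continuous_on by blast

lemma sq_integrable_H1_loop: "H1_loop f \<Longrightarrow> sq_integrable period_measure f"
  by (intro sq_integrable_continuous H1_loop_continuous_on)

lemma
  assumes f: "H1_weak_limit f F"
  shows H1_weak_limit_H1_loop: "H1_loop F"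
    and H1_weak_limit_wderiv: "sq_integrable period_measure \<psi> \<Longrightarrow>
      (\<lambda>n. L2_inner period_measure (wderiv (f n)) \<psi>) \<longlonglongrightarrow> L2_inner period_measure (wderiv F) \<psi>"
proof -
  note H1 = H1_weak_limit_seq[OF f] and lim = H1_weak_limit_pointwise[OF f]
  obtain C where C: "\<And>n. energy period_measure (wderiv (f n)) \<le> C"
    using f by (auto simp: H1_weak_limit_def)
  obtain G where G: "has_L2_derivative F G" and G_lim: "\<And>\<psi>. sq_integrable period_measure \<psi> \<Longrightarrow>
      (\<lambda>n. L2_inner period_measure (wderiv (f n)) \<psi>) \<longlonglongrightarrow> L2_inner period_measure G \<psi>"
    by (rule weak_derivative_limit[OF H1_loop_wderiv[OF H1] C lim]) (rule that)
  have per: "F (t + 2*pi) = F t" for t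
    using lim[of "t + 2*pi"] lim[of t] H1 by (intro LIMSEQ_unique[of "\<lambda>n. f n t"]) (auto simp: H1_loop_def)
  note F_wderiv = is_wderiv_periodic_extension[OF per G]
  then show F: "H1_loop F" using per by (auto simp: H1_loop_def)
  have "AE t in period_measure. wderiv F t = G t"
    using wderiv_AE_eq[OF F_wderiv] periodic_extension_AE_eq[of G] by eventually_elim simp
  then show "(\<lambda>n. L2_inner period_measure (wderiv (f n)) \<psi>) \<longlonglongrightarrow> L2_inner period_measure (wderiv F) \<psi>"
    if "sq_integrable period_measure \<psi>"
    using G_lim[OF that]
      L2_inner_cong_AE[OF sq_integrable_wderiv[OF F] has_L2_derivative_sq_integrable[OF G] that]
    by simp
qed

lemma H1_loop_norm_le:
  assumes f: "H1_loop f"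
  shows "norm (f t) \<le> norm (f 0) + sqrt (2*pi * energy period_measure (wderiv f))"
proof -
  have "norm (f (t rmod (2*pi)) - f 0) \<le> sqrt (\<bar>t rmod (2*pi) - 0\<bar> * energy period_measure (wderiv f))"
    using rmod_period_in by (intro is_wderiv_Hoelder[OF H1_loop_wderiv[OF f]]) auto
  also have "\<dots> \<le> sqrt (2*pi * energy period_measure (wderiv f))"
    using rmod_period_in[of t] by (intro real_sqrt_le_mono mult_right_mono energy_nonneg) auto
  finally show ?thesis
    using norm_triangle_sub[of "f t" "f 0"] by (simp add: H1_loop_rmod[OF f])
qed

lemma H1_weak_limit_bounded:
  assumes f: "H1_weak_limit f F"
  obtains B where "\<And>n t. norm (f n t) \<le> B"
proof -
  obtain C where C: "\<And>n. energy period_measure (wderiv (f n)) \<le> C"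
    using f by (auto simp: H1_weak_limit_def)
  obtain B where B: "\<And>n. norm (f n 0) \<le> B"
    using convergent_imp_bounded[OF H1_weak_limit_pointwise[OF f, of 0]] by (auto simp: bounded_iff)
  have "norm (f n t) \<le> B + sqrt (2*pi * C)" for n t
  proof -
    have "sqrt (2*pi * energy period_measure (wderiv (f n))) \<le> sqrt (2*pi * C)"
      using C by (intro real_sqrt_le_mono mult_left_mono) auto
    with H1_loop_norm_le[OF H1_weak_limit_seq[OF f], of n t] B[of n] show ?thesis by linarith
  qed
  then show ?thesis by (rule that)
qed

lemma (in finite_measure) L2_inner_bounded_convergence:
  fixes f :: "nat \<Rightarrow> 'a \<Rightarrow> 'b::euclidean_space"
  assumes f: "\<And>n. f n \<in> borel_measurable M" and F: "F \<in> borel_measurable M"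
    and bound: "\<And>n x. norm (f n x) \<le> B"
    and lim: "\<And>x. (\<lambda>n. f n x) \<longlonglongrightarrow> F x" and \<psi>: "sq_integrable M \<psi>"
  shows "(\<lambda>n. L2_inner M (f n) \<psi>) \<longlonglongrightarrow> L2_inner M F \<psi>"
  unfolding L2_inner_def
proof (rule integral_dominated_convergence)
  note sq_integrable_measurable[OF \<psi>, measurable] f[measurable] F[measurable]
  show "(\<lambda>x. F x \<bullet> \<psi> x) \<in> borel_measurable M" "(\<lambda>x. f n x \<bullet> \<psi> x) \<in> borel_measurable M" for n
    by measurable
  show "integrable M (\<lambda>x. B * norm (\<psi> x))"
    using sq_integrable_imp_integrable[OF \<psi>] by simp
  show "AE x in M. (\<lambda>n. f n x \<bullet> \<psi> x) \<longlonglongrightarrow> F x \<bullet> \<psi> x"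
    by (intro AE_I2 tendsto_intros lim)
  have "norm (f n x \<bullet> \<psi> x) \<le> B * norm (\<psi> x)" for n x
    using Cauchy_Schwarz_ineq2[of "f n x" "\<psi> x"] mult_right_mono[OF bound norm_ge_zero, of n x "\<psi> x"] by simp
  then show "AE x in M. norm (f n x \<bullet> \<psi> x) \<le> B * norm (\<psi> x)" for n
    by (intro AE_I2)
qed

lemma H1_weak_limit_bounded_linear:
  assumes f: "H1_weak_limit f F" and L: "bounded_linear L" and \<psi>: "sq_integrable period_measure \<psi>"
  shows "(\<lambda>n. L2_inner period_measure (\<lambda>t. L (f n t)) \<psi>) \<longlonglongrightarrow> L2_inner period_measure (\<lambda>t. L (F t)) \<psi>"
proof -
  interpret bounded_linear L by fact
  obtain B where "\<And>n t. norm (f n t) \<le> B" using H1_weak_limit_bounded[OF f] by blast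
  moreover obtain K where "0 < K" "\<And>x. norm (L x) \<le> norm x * K" using pos_bounded by blast
  ultimately have "norm (L (f n t)) \<le> B * K" for n t
    by (meson mult_right_mono less_imp_le order_trans)
  then show ?thesis
    by (intro interval_measure.L2_inner_bounded_convergence[of _ _ _ _ "B * K"] \<psi> tendsto
        H1_weak_limit_pointwise[OF f] sq_integrable_measurable sq_integrable_bounded_linear[OF L]
        sq_integrable_H1_loop H1_weak_limit_seq[OF f] H1_weak_limit_H1_loop[OF f])
qed

lemma H1_loop_Arzela_Ascoli:
  fixes f :: "nat \<Rightarrow> real \<Rightarrow> 'a::euclidean_space"
  assumes f: "\<And>n. H1_loop (f n)" and C: "\<And>n. energy period_measure (wderiv (f n)) \<le> C"
    and B: "\<And>n t. t \<in> {0..2*pi} \<Longrightarrow> norm (f n t) \<le> B"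
  obtains r F where "strict_mono (r :: nat \<Rightarrow> nat)" "\<And>t. (\<lambda>n. f (r n) t) \<longlonglongrightarrow> F t"
proof -
  obtain g r where r: "strict_mono (r :: nat \<Rightarrow> nat)"
    and conv: "\<And>e. 0 < e \<Longrightarrow> \<exists>k. \<forall>n t. n \<ge> k \<and> t \<in> {0..2*pi} \<longrightarrow> norm (f (r n) t - g t) < e"
  proof (rule Arzela_Ascoli[of "{0..2*pi}" f B])
    fix t e :: real assume t: "t \<in> {0..2*pi}" and e: "0 < e"
    have "0 \<le> C" using C[of 0] energy_nonneg order_trans by blast
    have "norm (f n t - f n s) < e" if s: "s \<in> {0..2*pi}" "norm (t - s) < e\<^sup>2 / (C + 1)" for n s
    proof -
      have "norm (f n t - f n s) \<le> sqrt (\<bar>t - s\<bar> * energy period_measure (wderiv (f n)))"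
        by (rule is_wderiv_Hoelder[OF H1_loop_wderiv[OF f] t s(1)])
      also have "\<dots> \<le> sqrt (\<bar>t - s\<bar> * (C + 1))"
        using C[of n] by (intro real_sqrt_le_mono mult_left_mono) auto
      also have "\<dots> < sqrt (e\<^sup>2)"
        using s(2) \<open>0 \<le> C\<close> by (intro real_sqrt_less_mono) (simp add: field_simps)
      finally show ?thesis using e by simp
    qed
    then show "\<exists>d>0. \<forall>n s. s \<in> {0..2*pi} \<and> norm (t - s) < d \<longrightarrow> norm (f n t - f n s) < e"
      using e \<open>0 \<le> C\<close> by (intro exI[of _ "e\<^sup>2 / (C + 1)"]) auto
  qed (use B in auto)
  have "(\<lambda>n. f (r n) t) \<longlonglongrightarrow> g (t rmod (2*pi))" for t
  proof -
    have "(\<lambda>n. f (r n) (t rmod (2*pi))) \<longlonglongrightarrow> g (t rmod (2*pi))"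
      using conv rmod_period_in[of t] unfolding LIMSEQ_iff by blast
    then show ?thesis by (simp add: H1_loop_rmod[OF f])
  qed
  with r show ?thesis by (rule that)
qed

section \<open>Lower semicontinuity of the action\<close>

definition coriolis :: "real \<Rightarrow> complex \<times> real \<Rightarrow> complex \<times> real" where
  "coriolis \<omega> p = (\<i> * complex_of_real \<omega> * fst p, 0)"

definition rot_vel :: "real \<Rightarrow> (real \<Rightarrow> complex \<times> real) \<Rightarrow> real \<Rightarrow> complex \<times> real" where
  "rot_vel \<omega> f t = wderiv f t + coriolis \<omega> (f t)"

definition kinetic_action :: "nat \<Rightarrow> real \<Rightarrow> loop \<Rightarrow> real" where
  "kinetic_action N \<omega> q = 1/2 * (\<Sum>i<N. energy period_measure (rot_vel \<omega> (q i)))"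

definition potential_action :: "nat \<Rightarrow> loop \<Rightarrow> ennreal" where
  "potential_action N q = (\<integral>\<^sup>+t. potential N (\<lambda>i. q i t) \<partial>period_measure)"

lemma bounded_linear_coriolis: "bounded_linear (coriolis \<omega>)"
  unfolding coriolis_def[abs_def]
  by (intro bounded_linear_Pair bounded_linear_zero
      bounded_linear_compose[OF bounded_linear_mult_right bounded_linear_fst])

lemma norm_coriolis_le: "norm (coriolis \<omega> p) \<le> \<bar>\<omega>\<bar> * norm p"
  using norm_fst_le[of "fst p" "snd p"] by (simp add: coriolis_def norm_Pair norm_mult mult_left_mono)

lemma norm_rot_vel_square:
  "(norm (rot_vel \<omega> f t))\<^sup>2 =
    (cmod (fst (wderiv f t) + \<i> * complex_of_real \<omega> * fst (f t)))\<^sup>2 + (snd (wderiv f t))\<^sup>2"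
  by (simp add: rot_vel_def coriolis_def norm_prod_def)

lemma sq_integrable_coriolis: "H1_loop f \<Longrightarrow> sq_integrable period_measure (\<lambda>t. coriolis \<omega> (f t))"
  by (intro sq_integrable_bounded_linear[OF bounded_linear_coriolis] sq_integrable_H1_loop)

lemma sq_integrable_rot_vel: "H1_loop f \<Longrightarrow> sq_integrable period_measure (rot_vel \<omega> f)"
  unfolding rot_vel_def[abs_def] by (intro sq_integrable_add sq_integrable_wderiv sq_integrable_coriolis)

lemma energy_wderiv_le:
  assumes f: "H1_loop f" and B: "\<And>t. t \<in> {0..2*pi} \<Longrightarrow> norm (f t) \<le> B"
  shows "energy period_measure (wderiv f)
    \<le> 2 * energy period_measure (rot_vel \<omega> f) + 2 * (2*pi * (\<bar>\<omega>\<bar> * B)\<^sup>2)"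
proof -
  have "wderiv f = (\<lambda>t. rot_vel \<omega> f t + coriolis (- \<omega>) (f t))"
    by (auto simp: rot_vel_def coriolis_def fun_eq_iff prod_eq_iff)
  then have "energy period_measure (wderiv f)
      \<le> 2 * energy period_measure (rot_vel \<omega> f) + 2 * energy period_measure (\<lambda>t. coriolis (- \<omega>) (f t))"
    using energy_add_le[OF sq_integrable_rot_vel[OF f, of \<omega>] sq_integrable_coriolis[OF f, of "- \<omega>"]] by simp
  moreover have "energy period_measure (\<lambda>t. coriolis (- \<omega>) (f t))
      \<le> measure period_measure (space period_measure) * (\<bar>\<omega>\<bar> * B)\<^sup>2"
  proof (rule interval_measure.sq_integrable_bounded(2))
    show "(\<lambda>t. coriolis (- \<omega>) (f t)) \<in> borel_measurable period_measure"
      by (rule sq_integrable_measurable[OF sq_integrable_coriolis[OF f]])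
    show "norm (coriolis (- \<omega>) (f t)) \<le> \<bar>\<omega>\<bar> * B" if "t \<in> space period_measure" for t
      using that B[of t] order_trans[OF norm_coriolis_le[of "- \<omega>" "f t"]]
      by (simp add: space_period_measure mult_left_mono)
  qed
  ultimately show ?thesis by (simp add: space_period_measure measure_period_measure)
qed

text \<open>Here \<open>inverse 0 = \<infinity>\<close> absorbs the collision case of \<open>potential\<close>.\<close>

lemma potential_eq:
  "potential N x = (\<Sum>i<N. \<Sum>j\<in>{i<..<N}. inverse (ennreal (norm (x i - x j))))"
proof (cases "\<exists>i<N. \<exists>j<N. i \<noteq> j \<and> x i = x j")
  case True
  then obtain i j where ij: "i < j" "j < N" "x i = x j"
    by (metis nat_neq_iff)
  have "top = inverse (ennreal (norm (x i - x j)))" using ij by simp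
  also have "\<dots> \<le> (\<Sum>j\<in>{i<..<N}. inverse (ennreal (norm (x i - x j))))"
    using ij by (intro member_le_sum) auto
  also have "\<dots> \<le> (\<Sum>i<N. \<Sum>j\<in>{i<..<N}. inverse (ennreal (norm (x i - x j))))"
    using ij by (intro member_le_sum[where f="\<lambda>i. \<Sum>j\<in>{i<..<N}. inverse (ennreal (norm (x i - x j)))"]) auto
  finally have "(\<Sum>i<N. \<Sum>j\<in>{i<..<N}. inverse (ennreal (norm (x i - x j)))) = top"
    by (simp only: top_unique)
  then show ?thesis using True by (simp only: potential_def if_True infinity_ennreal_def)
next
  case False
  then have "potential N x = (\<Sum>i<N. \<Sum>j\<in>{i<..<N}. ennreal (1 / norm (x i - x j)))"
    by (auto simp: potential_def)
  also have "\<dots> = (\<Sum>i<N. \<Sum>j\<in>{i<..<N}. inverse (ennreal (norm (x i - x j))))"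
  proof (intro sum.cong refl)
    fix i j assume "i \<in> {..<N}" "j \<in> {i<..<N}"
    then have "x i \<noteq> x j" using False less_trans[of i j N] by (metis greaterThanLessThan_iff less_irrefl)
    then show "ennreal (1 / norm (x i - x j)) = inverse (ennreal (norm (x i - x j)))"
      by (simp add: inverse_ennreal inverse_eq_divide)
  qed
  finally show ?thesis .
qed

lemma potential_tendsto:
  assumes "\<And>i. i < N \<Longrightarrow> (\<lambda>n. x n i) \<longlonglongrightarrow> y i"
  shows "(\<lambda>n. potential N (x n)) \<longlonglongrightarrow> potential N y"
  unfolding potential_eq
proof (intro tendsto_sum)
  fix i j assume "i \<in> {..<N}" "j \<in> {i<..<N}"
  then have "(\<lambda>n. ennreal (norm (x n i - x n j))) \<longlonglongrightarrow> ennreal (norm (y i - y j))"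
    by (intro tendsto_ennrealI tendsto_intros assms) auto
  then show "(\<lambda>n. inverse (ennreal (norm (x n i - x n j)))) \<longlonglongrightarrow> inverse (ennreal (norm (y i - y j)))"
    by (rule continuous_on_tendsto_compose[OF
          continuous_on_inverse_ennreal[OF continuous_on_id[of UNIV]]]) auto
qed

lemma borel_measurable_potential:
  assumes "in_Lambda N q"
  shows "(\<lambda>t. potential N (\<lambda>i. q i t)) \<in> borel_measurable period_measure"
  unfolding potential_eq
proof (intro borel_measurable_sum)
  fix i j assume "i \<in> {..<N}" "j \<in> {i<..<N}"
  then have [measurable]: "q i \<in> borel_measurable period_measure" "q j \<in> borel_measurable period_measure"
    using assms by (auto simp: in_Lambda_def intro!: sq_integrable_measurable sq_integrable_H1_loop)
  show "(\<lambda>t. inverse (ennreal (norm (q i t - q j t)))) \<in> borel_measurable period_measure"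
    by measurable
qed

lemma action_eq:
  assumes q: "in_Lambda N q"
  shows "action N \<omega> q 0 (2*pi) = ennreal (kinetic_action N \<omega> q) + potential_action N q"
proof -
  have i: "integrable period_measure (\<lambda>t. (norm (rot_vel \<omega> (q i) t))\<^sup>2)" if "i < N" for i
    using q that by (intro sq_integrable_norm_square sq_integrable_rot_vel) (simp add: in_Lambda_def)
  then have int: "integrable period_measure (\<lambda>t. 1/2 * (\<Sum>i<N. (norm (rot_vel \<omega> (q i) t))\<^sup>2))"
    by (intro integrable_mult_right Bochner_Integration.integrable_sum) auto
  have "action N \<omega> q 0 (2*pi) = (\<integral>\<^sup>+t. ennreal (1/2 * (\<Sum>i<N. (norm (rot_vel \<omega> (q i) t))\<^sup>2))
      + potential N (\<lambda>i. q i t) \<partial>period_measure)"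
    unfolding action_def norm_rot_vel_square by (rule nn_integral_restrict_space[symmetric]) simp
  also have "\<dots> = (\<integral>\<^sup>+t. ennreal (1/2 * (\<Sum>i<N. (norm (rot_vel \<omega> (q i) t))\<^sup>2)) \<partial>period_measure)
      + potential_action N q"
    unfolding potential_action_def
    using borel_measurable_integrable[OF int] borel_measurable_potential[OF q]
    by (intro nn_integral_add) auto
  also have "(\<integral>\<^sup>+t. ennreal (1/2 * (\<Sum>i<N. (norm (rot_vel \<omega> (q i) t))\<^sup>2)) \<partial>period_measure)
      = ennreal (\<integral>t. 1/2 * (\<Sum>i<N. (norm (rot_vel \<omega> (q i) t))\<^sup>2) \<partial>period_measure)"
    by (intro nn_integral_eq_integral int) (auto intro!: sum_nonneg)
  also have "(\<integral>t. 1/2 * (\<Sum>i<N. (norm (rot_vel \<omega> (q i) t))\<^sup>2) \<partial>period_measure) = kinetic_action N \<omega> q"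
    using i by (simp add: kinetic_action_def energy_def Bochner_Integration.integral_sum)
  finally show ?thesis .
qed

lemma energy_rot_vel_le_action:
  assumes q: "in_Lambda N q" and le: "action N \<omega> q 0 (2*pi) \<le> ennreal A" and "0 \<le> A" and "i < N"
  shows "energy period_measure (rot_vel \<omega> (q i)) \<le> 2 * A"
proof -
  have "energy period_measure (rot_vel \<omega> (q i)) \<le> (\<Sum>i<N. energy period_measure (rot_vel \<omega> (q i)))"
    using \<open>i < N\<close> by (intro member_le_sum[where f="\<lambda>i. energy period_measure (rot_vel \<omega> (q i))"])
      (auto simp: energy_nonneg)
  moreover have "ennreal (kinetic_action N \<omega> q) \<le> ennreal A"
    using le unfolding action_eq[OF q] by (rule order_trans[rotated]) simp
  then have "kinetic_action N \<omega> q \<le> A"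
    using \<open>0 \<le> A\<close> by simp
  ultimately show ?thesis by (simp add: kinetic_action_def)
qed

definition weak_limit :: "nat \<Rightarrow> (nat \<Rightarrow> loop) \<Rightarrow> loop \<Rightarrow> bool" where
  "weak_limit N q Q \<longleftrightarrow> (\<forall>i<N. H1_weak_limit (\<lambda>n. q n i) (Q i))"

lemma weak_limit_component: "weak_limit N q Q \<Longrightarrow> i < N \<Longrightarrow> H1_weak_limit (\<lambda>n. q n i) (Q i)"
  by (simp add: weak_limit_def)

lemma weak_limit_in_Lambda:
  assumes "weak_limit N q Q" shows "in_Lambda N (q n)" and "in_Lambda N Q"
  using assms H1_weak_limit_seq[of "\<lambda>n. q n i" "Q i" n for i]
    H1_weak_limit_H1_loop[of "\<lambda>n. q n i" "Q i" for i]
  by (simp_all add: weak_limit_def in_Lambda_def)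

lemma H1_weak_limit_rot_vel:
  assumes f: "H1_weak_limit f F" and \<psi>: "sq_integrable period_measure \<psi>"
  shows "(\<lambda>n. L2_inner period_measure (rot_vel \<omega> (f n)) \<psi>) \<longlonglongrightarrow> L2_inner period_measure (rot_vel \<omega> F) \<psi>"
proof -
  have split: "L2_inner period_measure (rot_vel \<omega> h) \<psi>
      = L2_inner period_measure (wderiv h) \<psi> + L2_inner period_measure (\<lambda>t. coriolis \<omega> (h t)) \<psi>"
    if "H1_loop h" for h
    unfolding rot_vel_def[abs_def]
    by (rule L2_inner_add_left[OF sq_integrable_wderiv[OF that] sq_integrable_coriolis[OF that] \<psi>])
  show ?thesis
    unfolding split[OF H1_weak_limit_seq[OF f]] split[OF H1_weak_limit_H1_loop[OF f]]
    by (intro tendsto_add H1_weak_limit_wderiv[OF f \<psi>]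
        H1_weak_limit_bounded_linear[OF f bounded_linear_coriolis \<psi>])
qed

lemma kinetic_action_lower_semicontinuous:
  assumes q: "weak_limit N q Q" and "0 < \<epsilon>"
  shows "\<forall>\<^sub>F n in sequentially. kinetic_action N \<omega> Q \<le> kinetic_action N \<omega> (q n) + \<epsilon>"
proof -
  define \<delta> where "\<delta> = \<epsilon> / (real N + 1)"
  have "0 < \<delta>" using \<open>0 < \<epsilon>\<close> by (simp add: \<delta>_def)
  have "\<forall>\<^sub>F n in sequentially. energy period_measure (rot_vel \<omega> (Q i))
      \<le> energy period_measure (rot_vel \<omega> (q n i)) + \<delta>" if "i < N" for i
  proof (rule energy_weak_lower_semicontinuous)
    note lim = weak_limit_component[OF q that]
    show Q: "sq_integrable period_measure (rot_vel \<omega> (Q i))"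
      by (rule sq_integrable_rot_vel[OF H1_weak_limit_H1_loop[OF lim]])
    show "sq_integrable period_measure (rot_vel \<omega> (q n i))" for n
      by (rule sq_integrable_rot_vel[OF H1_weak_limit_seq[OF lim]])
    show "(\<lambda>n. L2_inner period_measure (rot_vel \<omega> (q n i)) (rot_vel \<omega> (Q i)))
        \<longlonglongrightarrow> energy period_measure (rot_vel \<omega> (Q i))"
      using H1_weak_limit_rot_vel[OF lim Q, of \<omega>] unfolding L2_inner_self .
  qed (rule \<open>0 < \<delta>\<close>)
  then have "\<forall>\<^sub>F n in sequentially. \<forall>i\<in>{..<N}. energy period_measure (rot_vel \<omega> (Q i))
      \<le> energy period_measure (rot_vel \<omega> (q n i)) + \<delta>"
    by (intro eventually_ball_finite) auto
  then show ?thesis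
  proof eventually_elim
    case (elim n)
    then have "(\<Sum>i<N. energy period_measure (rot_vel \<omega> (Q i)))
        \<le> (\<Sum>i<N. energy period_measure (rot_vel \<omega> (q n i)) + \<delta>)"
      by (intro sum_mono) auto
    moreover have "real N * \<delta> \<le> \<epsilon>" using \<open>0 < \<epsilon>\<close> by (simp add: \<delta>_def field_simps)
    ultimately show ?case
      using \<open>0 < \<epsilon>\<close> by (simp add: kinetic_action_def sum.distrib)
  qed
qed

lemma potential_action_lower_semicontinuous:
  assumes q: "weak_limit N q Q"
  shows "potential_action N Q \<le> liminf (\<lambda>n. potential_action N (q n))"
proof -
  have "potential_action N Q = (\<integral>\<^sup>+t. liminf (\<lambda>n. potential N (\<lambda>i. q n i t)) \<partial>period_measure)"
    unfolding potential_action_def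
    by (intro nn_integral_cong lim_imp_Liminf[symmetric] potential_tendsto
        H1_weak_limit_pointwise[OF weak_limit_component[OF q]]) simp_all
  also have "\<dots> \<le> liminf (\<lambda>n. potential_action N (q n))"
    unfolding potential_action_def
    by (intro nn_integral_liminf borel_measurable_potential weak_limit_in_Lambda(1)[OF q])
  finally show ?thesis .
qed

lemma action_lower_semicontinuous:
  assumes q: "weak_limit N q Q"
  shows "action N \<omega> Q 0 (2*pi) \<le> liminf (\<lambda>n. action N \<omega> (q n) 0 (2*pi))"
proof (rule ennreal_le_epsilon)
  fix e :: real assume "0 < e"
  let ?K = "\<lambda>q. ennreal (kinetic_action N \<omega> q)"
  have nonneg: "0 \<le> kinetic_action N \<omega> p" for p
    by (simp add: kinetic_action_def sum_nonneg energy_nonneg)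
  have "action N \<omega> Q 0 (2*pi) \<le> liminf (\<lambda>n. potential_action N (q n)) + ?K Q"
    unfolding action_eq[OF weak_limit_in_Lambda(2)[OF q]] add.commute[of _ "potential_action N Q"]
    by (intro add_right_mono potential_action_lower_semicontinuous q)
  also have "\<dots> = liminf (\<lambda>n. potential_action N (q n) + ?K Q)"
    by (rule Liminf_add_const[symmetric]) simp
  also have "\<dots> \<le> liminf (\<lambda>n. action N \<omega> (q n) 0 (2*pi) + ennreal e)"
  proof (rule Liminf_mono, use kinetic_action_lower_semicontinuous[OF q \<open>0 < e\<close>, of \<omega>] in eventually_elim)
    case (elim n)
    then have "?K Q \<le> ?K (q n) + ennreal e"
      using \<open>0 < e\<close> nonneg by (simp add: ennreal_leI flip: ennreal_plus)
    then have "potential_action N (q n) + ?K Q \<le> potential_action N (q n) + (?K (q n) + ennreal e)"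
      by (rule add_left_mono)
    then show ?case
      unfolding action_eq[OF weak_limit_in_Lambda(1)[OF q]] by (simp add: ac_simps)
  qed
  also have "\<dots> = liminf (\<lambda>n. action N \<omega> (q n) 0 (2*pi)) + ennreal e"
    by (rule Liminf_add_const) simp
  finally show "action N \<omega> Q 0 (2*pi) \<le> liminf (\<lambda>n. action N \<omega> (q n) 0 (2*pi)) + ennreal e" .
qed

section \<open>Existence of minimisers by the direct method\<close>

lemma Lambda_DN_in_Lambda: "Lambda_DN N q \<Longrightarrow> in_Lambda N q"
  by (simp add: Lambda_DN_def)

lemma Lambda_DN_H1_loop: "Lambda_DN N q \<Longrightarrow> i < N \<Longrightarrow> H1_loop (q i)"
  by (simp add: Lambda_DN_def in_Lambda_def)

lemma Lambda_DN_shift: "Lambda_DN N q \<Longrightarrow> i < N \<Longrightarrow> q i t = q 0 (t + 2*pi * real i / real N)"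
  unfolding Lambda_DN_def by blast

lemma Lambda_DN_reflect: "Lambda_DN N q \<Longrightarrow> q 0 (2*pi - t) = refl_xz (q 0 t)"
  unfolding Lambda_DN_def by blast

lemma Lambda_DN_norm_le:
  assumes q: "Lambda_DN N q" and "i < N" and B: "\<And>s. s \<in> {0..2*pi} \<Longrightarrow> norm (q 0 s) \<le> B"
  shows "norm (q i t) \<le> B"
  using Lambda_DN_shift[OF q \<open>i < N\<close>, of t] H1_loop_rmod[OF Lambda_DN_H1_loop[OF q, of 0]] \<open>i < N\<close>
    B[OF rmod_period_in] by (metis less_nat_zero_code not_gr_zero)

lemma Lambda_DN_weak_limit:
  assumes "0 < N" and q: "\<And>n. Lambda_DN N (q n)" and lim: "weak_limit N q Q"
  shows "Lambda_DN N Q"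
  unfolding Lambda_DN_def
proof (intro conjI allI impI)
  note pointwise = H1_weak_limit_pointwise[OF weak_limit_component[OF lim]]
  show "in_Lambda N Q" by (rule weak_limit_in_Lambda(2)[OF lim])
  show "Q i t = Q 0 (t + 2*pi * real i / real N)" if "i < N" for i t
    using pointwise[OF that, of t] pointwise[OF \<open>0 < N\<close>] unfolding Lambda_DN_shift[OF q that]
    by (rule LIMSEQ_unique)
  have "(\<lambda>n. refl_xz (q n 0 t)) \<longlonglongrightarrow> refl_xz (Q 0 t)" for t
    unfolding refl_xz_def by (intro tendsto_intros pointwise \<open>0 < N\<close>)
  then show "Q 0 (2*pi - t) = refl_xz (Q 0 t)" for t
    using pointwise[OF \<open>0 < N\<close>, of "2*pi - t"] unfolding Lambda_DN_reflect[OF q] by (metis LIMSEQ_unique)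
qed

lemma H1_inner_eq:
  assumes q: "in_Lambda N q" and h: "in_Lambda N h"
  shows "H1_inner N q h = (\<Sum>i<N. L2_inner period_measure (q i) (h i)
    + L2_inner period_measure (wderiv (q i)) (wderiv (h i)))"
  unfolding H1_inner_def set_integral_interval L2_inner_def
  using q h by (intro sum.cong refl Bochner_Integration.integral_add integrable_inner sq_integrable_H1_loop
      sq_integrable_wderiv) (auto simp: in_Lambda_def)

lemma H1_inner_weak_limit:
  assumes q: "weak_limit N q Q" and h: "in_Lambda N h"
  shows "(\<lambda>n. H1_inner N (q n) h) \<longlonglongrightarrow> H1_inner N Q h"
  unfolding H1_inner_eq[OF weak_limit_in_Lambda(1)[OF q] h] H1_inner_eq[OF weak_limit_in_Lambda(2)[OF q] h]
proof (intro tendsto_sum tendsto_add)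
  fix i assume "i \<in> {..<N}"
  then have lim: "H1_weak_limit (\<lambda>n. q n i) (Q i)" and h_i: "H1_loop (h i)"
    using q h by (auto simp: weak_limit_def in_Lambda_def)
  show "(\<lambda>n. L2_inner period_measure (q n i) (h i)) \<longlonglongrightarrow> L2_inner period_measure (Q i) (h i)"
    by (rule H1_weak_limit_bounded_linear[OF lim bounded_linear_ident sq_integrable_H1_loop[OF h_i]])
  show "(\<lambda>n. L2_inner period_measure (wderiv (q n i)) (wderiv (h i)))
      \<longlonglongrightarrow> L2_inner period_measure (wderiv (Q i)) (wderiv (h i))"
    by (rule H1_weak_limit_wderiv[OF lim sq_integrable_wderiv[OF h_i]])
qed

lemma weak_closure_DN_approximation:
  assumes "q \<in> weak_closure_DN N S" "finite H" "H \<subseteq> {h. in_Lambda N h}" "0 < \<epsilon>"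
  obtains p where "p \<in> S" "\<And>h. h \<in> H \<Longrightarrow> \<bar>H1_inner N p h - H1_inner N q h\<bar> < \<epsilon>"
proof -
  have "\<exists>p\<in>S. \<forall>h\<in>H. \<bar>H1_inner N p h - H1_inner N q h\<bar> < \<epsilon>"
    using assms by (simp add: weak_closure_DN_def)
  with that show ?thesis by blast
qed

definition weakly_closed :: "nat \<Rightarrow> loop set \<Rightarrow> bool" where
  "weakly_closed N S \<longleftrightarrow> (\<forall>q Q. (\<forall>n. q n \<in> S) \<longrightarrow> weak_limit N q Q \<longrightarrow> Q \<in> S)"

lemma weakly_closedD: "weakly_closed N S \<Longrightarrow> (\<And>n. q n \<in> S) \<Longrightarrow> weak_limit N q Q \<Longrightarrow> Q \<in> S"
  unfolding weakly_closed_def by blast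

lemma weakly_closed_weak_closure_DN:
  assumes "0 < N" shows "weakly_closed N (weak_closure_DN N S)"
  unfolding weakly_closed_def
proof (intro allI impI)
  fix q Q assume q: "\<forall>n. q n \<in> weak_closure_DN N S" and lim: "weak_limit N q Q"
  have "\<exists>p\<in>S. \<forall>h\<in>H. \<bar>H1_inner N p h - H1_inner N Q h\<bar> < \<epsilon>"
    if H: "finite H" "H \<subseteq> {h. in_Lambda N h}" and "0 < \<epsilon>" for H \<epsilon>
  proof -
    have "\<forall>\<^sub>F n in sequentially. \<forall>h\<in>H. dist (H1_inner N (q n) h) (H1_inner N Q h) < \<epsilon> / 2"
      using H \<open>0 < \<epsilon>\<close> by (intro eventually_ball_finite ballI tendstoD H1_inner_weak_limit[OF lim]) auto
    then obtain n where n: "\<And>h. h \<in> H \<Longrightarrow> \<bar>H1_inner N (q n) h - H1_inner N Q h\<bar> < \<epsilon> / 2"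
      using eventually_happens'[OF sequentially_bot] unfolding dist_real_def by blast
    obtain p where p: "p \<in> S" "\<And>h. h \<in> H \<Longrightarrow> \<bar>H1_inner N p h - H1_inner N (q n) h\<bar> < \<epsilon> / 2"
      using weak_closure_DN_approximation[OF q[rule_format] H half_gt_zero[OF \<open>0 < \<epsilon>\<close>]] by blast
    have "\<bar>H1_inner N p h - H1_inner N Q h\<bar> < \<epsilon>" if "h \<in> H" for h
      using n[OF that] p(2)[OF that] by linarith
    with p(1) show ?thesis by blast
  qed
  moreover have "Lambda_DN N Q"
    using q by (intro Lambda_DN_weak_limit[OF \<open>0 < N\<close> _ lim]) (simp add: weak_closure_DN_def)
  ultimately show "Q \<in> weak_closure_DN N S" by (simp add: weak_closure_DN_def)
qed

lemma bounded_action_weak_compactness: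
  assumes "0 < N" and q: "\<And>n. Lambda_DN N (q n)"
    and act: "\<And>n. action N \<omega> (q n) 0 (2*pi) \<le> ennreal A" and "0 \<le> A"
    and B: "\<And>n t. t \<in> {0..2*pi} \<Longrightarrow> norm (q n 0 t) \<le> B"
  obtains r Q where "strict_mono (r :: nat \<Rightarrow> nat)" "weak_limit N (\<lambda>n. q (r n)) Q"
proof -
  define C where "C = 2 * (2 * A) + 2 * (2*pi * (\<bar>\<omega>\<bar> * B)\<^sup>2)"
  have C: "energy period_measure (wderiv (q n i)) \<le> C" if "i < N" for n i
    using energy_wderiv_le[OF Lambda_DN_H1_loop[OF q that] Lambda_DN_norm_le[OF q that B], of n \<omega>]
      energy_rot_vel_le_action[OF Lambda_DN_in_Lambda[OF q] act \<open>0 \<le> A\<close> that, of n]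
    by (simp add: C_def)
  obtain r F where r: "strict_mono (r :: nat \<Rightarrow> nat)" and F: "\<And>t. (\<lambda>n. q (r n) 0 t) \<longlonglongrightarrow> F t"
    using H1_loop_Arzela_Ascoli[of "\<lambda>n. q n 0", OF Lambda_DN_H1_loop[OF q \<open>0 < N\<close>] C[OF \<open>0 < N\<close>] B] by blast
  have "weak_limit N (\<lambda>n. q (r n)) (\<lambda>i t. F (t + 2*pi * real i / real N))"
    unfolding weak_limit_def H1_weak_limit_def
  proof (intro allI impI conjI exI)
    fix i n t assume "i < N"
    show "H1_loop (q (r n) i)" by (rule Lambda_DN_H1_loop[OF q \<open>i < N\<close>])
    show "energy period_measure (wderiv (q (r n) i)) \<le> C" by (rule C[OF \<open>i < N\<close>])
    show "(\<lambda>n. q (r n) i t) \<longlonglongrightarrow> F (t + 2*pi * real i / real N)"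
      unfolding Lambda_DN_shift[OF q \<open>i < N\<close>] by (rule F)
  qed
  with r show ?thesis by (rule that)
qed

lemma attains_minimum_if_limits_dominated:
  fixes f :: "'b \<Rightarrow> 'a::{complete_linorder, linorder_topology, first_countable_topology}"
  assumes "S \<noteq> {}"
    and limits: "\<And>u l. (\<And>n. u n \<in> S) \<Longrightarrow> (\<lambda>n. f (u n)) \<longlonglongrightarrow> l \<Longrightarrow> l < top \<Longrightarrow> \<exists>x\<in>S. f x \<le> l"
  shows "\<exists>x\<in>S. \<forall>y\<in>S. f x \<le> f y"
proof (cases "Inf (f ` S) = top")
  case True
  then have "f y = top" if "y \<in> S" for y
    using INF_lower[OF that, of f] by (simp add: top_unique)
  then show ?thesis using \<open>S \<noteq> {}\<close> by auto
next
  case False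
  obtain v where v: "\<And>n. v n \<in> f ` S" "v \<longlonglongrightarrow> Inf (f ` S)"
    using Inf_as_limit[of "f ` S"] \<open>S \<noteq> {}\<close> by auto
  from v(1) obtain u where u: "\<And>n. u n \<in> S" "\<And>n. v n = f (u n)"
    unfolding image_iff Bex_def by metis
  have "(\<lambda>n. f (u n)) \<longlonglongrightarrow> Inf (f ` S)"
    using v(2) by (simp flip: u(2))
  moreover have "Inf (f ` S) < top"
    using False top.not_eq_extremum by blast
  ultimately obtain x where "x \<in> S" "f x \<le> Inf (f ` S)"
    using limits[of u] u(1) by blast
  then show ?thesis by (meson INF_lower order_trans)
qed

text \<open>Coercivity is only needed up to replacing a loop by one of no larger action.\<close>

definition coercive :: "nat \<Rightarrow> real \<Rightarrow> loop set \<Rightarrow> bool" where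
  "coercive N \<omega> S \<longleftrightarrow> (\<forall>A\<ge>0. \<exists>B. \<forall>q\<in>S. action N \<omega> q 0 (2*pi) \<le> ennreal A \<longrightarrow>
     (\<exists>p\<in>S. action N \<omega> p 0 (2*pi) \<le> action N \<omega> q 0 (2*pi) \<and> (\<forall>t\<in>{0..2*pi}. norm (p 0 t) \<le> B)))"

lemma action_attains_minimum:
  assumes "0 < N" "S \<noteq> {}" and S: "S \<subseteq> {q. Lambda_DN N q}"
    and closed: "weakly_closed N S" and coercive: "coercive N \<omega> S"
  shows "\<exists>q\<in>S. \<forall>p\<in>S. action N \<omega> q 0 (2*pi) \<le> action N \<omega> p 0 (2*pi)"
proof (rule attains_minimum_if_limits_dominated[OF \<open>S \<noteq> {}\<close>])
  let ?act = "\<lambda>q. action N \<omega> q 0 (2*pi)"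
  fix u l assume u: "\<And>n. u n \<in> S" and lim: "(\<lambda>n. ?act (u n)) \<longlonglongrightarrow> l" and "l < top"
  then obtain b where b: "0 \<le> b" "l = ennreal b" by (cases l) auto
  obtain a where a: "0 \<le> a" "l < ennreal a"
    using b by (intro that[of "b + 1"]) (auto simp: ennreal_less_iff)
  obtain k where k: "\<And>n. n \<ge> k \<Longrightarrow> ?act (u n) \<le> ennreal a"
    using order_tendstoD(2)[OF lim a(2)] unfolding eventually_sequentially by (meson less_imp_le)
  obtain B where "\<forall>q\<in>S. ?act q \<le> ennreal a \<longrightarrow>
      (\<exists>p\<in>S. ?act p \<le> ?act q \<and> (\<forall>t\<in>{0..2*pi}. norm (p 0 t) \<le> B))"
    using coercive \<open>0 \<le> a\<close> unfolding coercive_def by blast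
  then have "\<forall>n. \<exists>p. p \<in> S \<and> ?act p \<le> ?act (u (n + k)) \<and> (\<forall>t\<in>{0..2*pi}. norm (p 0 t) \<le> B)"
    using u k by (meson le_add2)
  then obtain q where q: "\<And>n. q n \<in> S" "\<And>n. ?act (q n) \<le> ?act (u (n + k))"
    and B: "\<And>n t. t \<in> {0..2*pi} \<Longrightarrow> norm (q n 0 t) \<le> B"
    by metis
  have "?act (q n) \<le> ennreal a" for n
    using q(2)[of n] k[of "n + k"] by simp
  moreover have "Lambda_DN N (q n)" for n using S q(1) by blast
  ultimately obtain r Q where r: "strict_mono (r :: nat \<Rightarrow> nat)" and Q: "weak_limit N (\<lambda>n. q (r n)) Q"
    using bounded_action_weak_compactness[OF \<open>0 < N\<close>, of q \<omega> a B] \<open>0 \<le> a\<close> B by blast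
  have "Q \<in> S"
    using closed q(1) by (rule weakly_closedD[OF _ _ Q])
  moreover have "?act Q \<le> l"
  proof -
    have "?act Q \<le> liminf (\<lambda>n. ?act (q (r n)))"
      by (rule action_lower_semicontinuous[OF Q])
    also have "\<dots> \<le> liminf (\<lambda>n. ?act (u (r n + k)))"
      by (intro Liminf_mono always_eventually allI q(2))
    also have "\<dots> = l"
      using LIMSEQ_subseq_LIMSEQ[OF LIMSEQ_ignore_initial_segment[OF lim, of k] r]
      by (intro lim_imp_Liminf) (simp_all add: o_def)
    finally show ?thesis .
  qed
  ultimately show "\<exists>x\<in>S. ?act x \<le> l" by blast
qed

section \<open>A priori bounds in the rotating frame\<close>

definition rot_length :: "real \<Rightarrow> (real \<Rightarrow> complex \<times> real) \<Rightarrow> real" where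
  "rot_length \<omega> f = (\<integral>t. norm (rot_vel \<omega> f t) \<partial>period_measure)"

lemma rot_length_le_action:
  assumes q: "in_Lambda N q" and act: "action N \<omega> q 0 (2*pi) \<le> ennreal A" and "0 \<le> A" "i < N"
  shows "rot_length \<omega> (q i) \<le> 2 * sqrt (pi * A)"
proof -
  have "rot_length \<omega> (q i)
      \<le> sqrt (measure period_measure (space period_measure) * energy period_measure (rot_vel \<omega> (q i)))"
    unfolding rot_length_def using q \<open>i < N\<close>
    by (intro interval_measure.integral_norm_le_sqrt_energy sq_integrable_rot_vel) (simp add: in_Lambda_def)
  also have "\<dots> \<le> sqrt (2*pi * (2 * A))"
    using energy_rot_vel_le_action[OF q act \<open>0 \<le> A\<close> \<open>i < N\<close>]
    by (intro real_sqrt_le_mono) (simp add: space_period_measure measure_period_measure)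
  also have "\<dots> = sqrt (2\<^sup>2 * (pi * A))" by simp
  also have "\<dots> = 2 * sqrt (pi * A)" by (simp only: real_sqrt_mult real_sqrt_abs abs_numeral)
  finally show ?thesis .
qed

lemma integral_norm_le_rot_length:
  fixes g :: "real \<Rightarrow> 'a::euclidean_space"
  assumes f: "H1_loop f" and g: "integrable period_measure g"
    and le: "\<And>t. norm (g t) \<le> norm (rot_vel \<omega> f t)"
  shows "(\<integral>t. norm (g t) \<partial>period_measure) \<le> rot_length \<omega> f"
  unfolding rot_length_def
  using interval_measure.sq_integrable_imp_integrable[OF sq_integrable_rot_vel[OF f]]
  by (intro integral_mono integrable_norm g le)

lemma norm_snd_le_norm: "norm (snd p) \<le> norm p" and norm_fst_le_norm: "norm (fst p) \<le> norm p"
  using norm_snd_le[of "snd p" "fst p"] norm_fst_le[of "fst p" "snd p"] by simp_all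

lemma is_wderiv_cis:
  "is_wderiv (\<lambda>t. cis (\<omega> * t)) (\<lambda>t. \<i> * complex_of_real \<omega> * cis (\<omega> * t))"
proof (rule is_wderiv_C1)
  show "((\<lambda>t. cis (\<omega> * t)) has_vector_derivative \<i> * complex_of_real \<omega> * cis (\<omega> * t)) (at t)" for t
    unfolding has_vector_derivative_def
    by (auto intro!: derivative_eq_intros simp: scaleR_conv_of_real mult_ac)
qed (auto intro!: continuous_intros)

text \<open>Variation of constants: \<open>cis (\<omega>t) \<zeta>\<close> has the derivative \<open>cis (\<omega>t) (\<zeta>' + \<i>\<omega>\<zeta>)\<close>.\<close>

lemma rotated_displacement_le:
  assumes f: "H1_loop f" and t: "t \<in> {0..2*pi}"
  shows "cmod (cis (\<omega> * t) * fst (f t) - fst (f 0)) \<le> rot_length \<omega> f"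
proof -
  let ?g = "\<lambda>t. cis (\<omega> * t) * fst (wderiv f t) + fst (f t) * (\<i> * complex_of_real \<omega> * cis (\<omega> * t))"
  have g: "is_wderiv (\<lambda>t. cis (\<omega> * t) * fst (f t)) ?g"
    by (rule is_wderiv_mult[OF is_wderiv_cis
          is_wderiv_bounded_linear[OF bounded_linear_fst H1_loop_wderiv[OF f]]])
  have "?g t = cis (\<omega> * t) * fst (rot_vel \<omega> f t)" for t
    by (simp add: rot_vel_def coriolis_def algebra_simps)
  then have "norm (?g t) \<le> norm (rot_vel \<omega> f t)" for t
    using norm_fst_le_norm[of "rot_vel \<omega> f t"] by (simp add: norm_mult)
  then have "(\<integral>t. norm (?g t) \<partial>period_measure) \<le> rot_length \<omega> f"
    using is_wderiv_set_integrable[OF g, of 0 "2*pi"]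
    by (intro integral_norm_le_rot_length[OF f]) (simp_all add: integrable_interval_iff)
  then show ?thesis
    using is_wderiv_norm_diff_le[OF g t, of 0] by simp
qed

lemma norm_fst_le_rot_length:
  assumes "H1_loop f" "t \<in> {0..2*pi}"
  shows "cmod (fst (f t)) \<le> cmod (fst (f 0)) + rot_length \<omega> f"
  using rotated_displacement_le[OF assms, of \<omega>] norm_triangle_sub[of "cis (\<omega> * t) * fst (f t)" "fst (f 0)"]
  by (simp add: norm_mult)

lemma norm_start_le_rot_length:
  assumes f: "H1_loop f"
  shows "cmod (cis (2*pi*\<omega>) - 1) * cmod (fst (f 0)) \<le> rot_length \<omega> f"
proof -
  have "f (2*pi) = f 0" using f by (metis H1_loop_def add_0)
  then show ?thesis
    using rotated_displacement_le[OF f, of "2*pi" \<omega>]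
    by (simp add: mult.commute[of \<omega>] left_diff_distrib flip: norm_mult)
qed

lemma mean_zero_norm_le:
  assumes f: "is_wderiv f g" and mean: "(LINT t:{0..2*pi}|lborel. f t) = 0" and t: "t \<in> {0..2*pi}"
  shows "norm (f t) \<le> (\<integral>t. norm (g t) \<partial>period_measure)"
proof -
  have f_int: "integrable period_measure f"
    by (intro interval_measure.sq_integrable_imp_integrable sq_integrable_continuous
        is_wderiv_continuous_on[OF f])
  have "(\<integral>s. f t - f s \<partial>period_measure) = (2*pi) *\<^sub>R f t"
    using f_int mean by (simp add: set_integral_interval space_period_measure measure_period_measure)
  then have "2*pi * norm (f t) = norm (\<integral>s. f t - f s \<partial>period_measure)"
    by simp
  also have "\<dots> \<le> (\<integral>s. norm (f t - f s) \<partial>period_measure)"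
    by (rule integral_norm_bound)
  also have "\<dots> \<le> (\<integral>s. (\<integral>t. norm (g t) \<partial>period_measure) \<partial>period_measure)"
    using f_int is_wderiv_norm_diff_le[OF f t] by (intro integral_mono) (auto simp: space_period_measure)
  also have "\<dots> = 2*pi * (\<integral>t. norm (g t) \<partial>period_measure)"
    by (simp add: space_period_measure measure_period_measure)
  finally show ?thesis by (simp add: mult_le_cancel_left)
qed

lemma norm_le_rot_length:
  assumes f: "H1_loop f" and mean: "(LINT t:{0..2*pi}|lborel. snd (f t)) = 0" and t: "t \<in> {0..2*pi}"
  shows "norm (f t) \<le> cmod (fst (f 0)) + 2 * rot_length \<omega> f"
proof -
  have z: "is_wderiv (\<lambda>t. snd (f t)) (\<lambda>t. snd (wderiv f t))"
    by (rule is_wderiv_bounded_linear[OF bounded_linear_snd H1_loop_wderiv[OF f]])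
  have "\<bar>snd (f t)\<bar> \<le> (\<integral>t. norm (snd (wderiv f t)) \<partial>period_measure)"
    using mean_zero_norm_le[OF z mean t] by simp
  also have "\<dots> \<le> rot_length \<omega> f"
  proof (rule integral_norm_le_rot_length[OF f])
    show "integrable period_measure (\<lambda>t. snd (wderiv f t))"
      by (simp add: integrable_interval_iff is_wderiv_set_integrable[OF z])
    show "norm (snd (wderiv f t)) \<le> norm (rot_vel \<omega> f t)" for t
      using norm_snd_le_norm[of "rot_vel \<omega> f t"] by (simp add: rot_vel_def coriolis_def)
  qed
  finally show ?thesis
    using norm_fst_le_rot_length[OF f t, of \<omega>] norm_Pair_le[of "fst (f t)" "snd (f t)"] by simp
qed

lemma abs_Re_le_rot_length_zero:
  assumes f: "H1_loop f" and mean: "(LINT t:{0..2*pi}|lborel. Re (fst (f t))) = 0" and t: "t \<in> {0..2*pi}"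
  shows "\<bar>Re (fst (f t))\<bar> \<le> rot_length 0 f"
proof -
  have x: "is_wderiv (\<lambda>t. Re (fst (f t))) (\<lambda>t. Re (fst (wderiv f t)))"
    by (rule is_wderiv_bounded_linear[OF bounded_linear_Re
          is_wderiv_bounded_linear[OF bounded_linear_fst H1_loop_wderiv[OF f]]])
  have "\<bar>Re (fst (f t))\<bar> \<le> (\<integral>t. norm (Re (fst (wderiv f t))) \<partial>period_measure)"
    using mean_zero_norm_le[OF x mean t] by simp
  also have "\<dots> \<le> rot_length 0 f"
  proof (rule integral_norm_le_rot_length[OF f])
    show "integrable period_measure (\<lambda>t. Re (fst (wderiv f t)))"
      by (simp add: integrable_interval_iff is_wderiv_set_integrable[OF x])
    show "norm (Re (fst (wderiv f t))) \<le> norm (rot_vel 0 f t)" for t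
      using abs_Re_le_cmod[of "fst (wderiv f t)"] norm_fst_le_norm[of "wderiv f t"]
      by (simp add: rot_vel_def coriolis_def flip: zero_prod_def)
  qed
  finally show ?thesis .
qed

section \<open>Invariance under common rotations for integral angular velocity\<close>

definition spin :: "nat \<Rightarrow> real \<Rightarrow> real \<Rightarrow> complex \<times> real" where
  "spin m c t = (complex_of_real c * cis (- (real m * t)), 0)"

abbreviation add_spin :: "nat \<Rightarrow> real \<Rightarrow> loop \<Rightarrow> loop" where
  "add_spin m c q \<equiv> (\<lambda>i t. q i t + spin m c t)"

lemma cis_add_int_period: "cis (x + 2*pi * of_int k) = cis x"
  by (simp flip: cis_mult)

lemma spin_shift:
  assumes "0 < N" "N dvd m"
  shows "spin m c (t + 2*pi * real i / real N) = spin m c t"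
proof -
  obtain k where "m = N * k" using \<open>N dvd m\<close> by blast
  then have "- (real m * (t + 2*pi * real i / real N)) = - (real m * t) + 2*pi * of_int (- int (k * i))"
    using \<open>0 < N\<close> by (simp add: field_simps)
  then show ?thesis by (simp only: spin_def cis_add_int_period)
qed

lemma spin_reflect: "spin m c (2*pi - t) = refl_xz (spin m c t)"
proof -
  have "- (real m * (2*pi - t)) = real m * t + 2*pi * of_int (- int m)"
    by (simp add: field_simps)
  then have "cis (- (real m * (2*pi - t))) = cis (real m * t)" by (simp only: cis_add_int_period)
  then show ?thesis by (simp add: spin_def refl_xz_def cis_cnj)
qed

lemma is_wderiv_spin: "is_wderiv (spin m c) (\<lambda>t. - coriolis (real m) (spin m c t))"
proof -
  have "is_wderiv (\<lambda>t. (complex_of_real c * cis (- real m * t), 0::real))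
      (\<lambda>t. (complex_of_real c * (\<i> * complex_of_real (- real m) * cis (- real m * t)), 0))"
    by (rule is_wderiv_bounded_linear[OF _ is_wderiv_cis])
      (intro bounded_linear_Pair bounded_linear_mult_right bounded_linear_zero)
  then show ?thesis by (simp add: spin_def[abs_def] coriolis_def mult_ac)
qed

lemma H1_loop_spin: "H1_loop (spin m c)"
  unfolding H1_loop_def using spin_shift[of 1 m c _ 1] is_wderiv_spin by auto

lemma Lambda_DN_spin:
  assumes "0 < N" "N dvd m" shows "Lambda_DN N (\<lambda>i. spin m c)"
  unfolding Lambda_DN_def in_Lambda_def
  using H1_loop_spin spin_shift[OF assms] spin_reflect by simp

lemma H1_loop_add: "H1_loop f \<Longrightarrow> H1_loop g \<Longrightarrow> H1_loop (\<lambda>t. f t + g t)"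
  unfolding H1_loop_def using is_wderiv_add by metis

lemma in_Lambda_add: "in_Lambda N q \<Longrightarrow> in_Lambda N p \<Longrightarrow> in_Lambda N (\<lambda>i t. q i t + p i t)"
  unfolding in_Lambda_def by (intro allI impI H1_loop_add) blast+

lemma Lambda_DN_add:
  assumes q: "Lambda_DN N q" and p: "Lambda_DN N p"
  shows "Lambda_DN N (\<lambda>i t. q i t + p i t)"
  unfolding Lambda_DN_def
proof (intro conjI allI impI)
  show "in_Lambda N (\<lambda>i t. q i t + p i t)"
    by (intro in_Lambda_add Lambda_DN_in_Lambda q p)
  show "q i t + p i t = q 0 (t + 2*pi * real i / real N) + p 0 (t + 2*pi * real i / real N)"
    if "i < N" for i t
    by (simp only: Lambda_DN_shift[OF q that] Lambda_DN_shift[OF p that])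
  show "q 0 (2*pi - t) + p 0 (2*pi - t) = refl_xz (q 0 t + p 0 t)" for t
    unfolding Lambda_DN_reflect[OF q] Lambda_DN_reflect[OF p] by (simp add: refl_xz_def)
qed

lemma H1_inner_add:
  assumes q: "in_Lambda N q" and p: "in_Lambda N p" and h: "in_Lambda N h"
  shows "H1_inner N (\<lambda>i t. q i t + p i t) h = H1_inner N q h + H1_inner N p h"
  unfolding H1_inner_eq[OF in_Lambda_add[OF q p] h] H1_inner_eq[OF q h] H1_inner_eq[OF p h]
    sum.distrib[symmetric]
proof (intro sum.cong refl)
  fix i assume "i \<in> {..<N}"
  then have loops: "H1_loop (q i)" "H1_loop (p i)" "H1_loop (h i)"
    using q p h by (auto simp: in_Lambda_def)
  note wderivs = sq_integrable_wderiv[OF loops(1)] sq_integrable_wderiv[OF loops(2)]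
    sq_integrable_wderiv[OF loops(3)]
  have "AE t in period_measure. wderiv (\<lambda>t. q i t + p i t) t = wderiv (q i) t + wderiv (p i) t"
    by (rule wderiv_AE_eq[OF is_wderiv_add[OF H1_loop_wderiv[OF loops(1)] H1_loop_wderiv[OF loops(2)]]])
  then have "L2_inner period_measure (wderiv (\<lambda>t. q i t + p i t)) (wderiv (h i))
      = L2_inner period_measure (\<lambda>t. wderiv (q i) t + wderiv (p i) t) (wderiv (h i))"
    by (intro L2_inner_cong_AE sq_integrable_wderiv H1_loop_add sq_integrable_add loops)
  then show "L2_inner period_measure (\<lambda>t. q i t + p i t) (h i)
        + L2_inner period_measure (wderiv (\<lambda>t. q i t + p i t)) (wderiv (h i))
      = L2_inner period_measure (q i) (h i) + L2_inner period_measure (wderiv (q i)) (wderiv (h i))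
        + (L2_inner period_measure (p i) (h i) + L2_inner period_measure (wderiv (p i)) (wderiv (h i)))"
    using L2_inner_add_left[OF sq_integrable_H1_loop sq_integrable_H1_loop sq_integrable_H1_loop, OF loops]
      L2_inner_add_left[OF wderivs] by simp
qed

lemma weak_closure_DN_add:
  assumes q: "q \<in> weak_closure_DN N S" and p: "Lambda_DN N p"
    and S: "\<And>s. s \<in> S \<Longrightarrow> in_Lambda N s" "\<And>s. s \<in> S \<Longrightarrow> (\<lambda>i t. s i t + p i t) \<in> S"
  shows "(\<lambda>i t. q i t + p i t) \<in> weak_closure_DN N S"
  unfolding weak_closure_DN_def
proof (intro CollectI conjI allI impI)
  have q_DN: "Lambda_DN N q" using q by (simp add: weak_closure_DN_def)
  then show "Lambda_DN N (\<lambda>i t. q i t + p i t)" using p by (rule Lambda_DN_add)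
  fix H and \<epsilon> :: real assume H: "finite H" "H \<subseteq> {h. in_Lambda N h}" "0 < \<epsilon>"
  obtain s where s: "s \<in> S" "\<And>h. h \<in> H \<Longrightarrow> \<bar>H1_inner N s h - H1_inner N q h\<bar> < \<epsilon>"
    using weak_closure_DN_approximation[OF q H] by blast
  have "\<bar>H1_inner N (\<lambda>i t. s i t + p i t) h - H1_inner N (\<lambda>i t. q i t + p i t) h\<bar> < \<epsilon>" if "h \<in> H" for h
  proof -
    have h: "in_Lambda N h" using H(2) that by blast
    show ?thesis
      using s(2)[OF that] H1_inner_add[OF S(1)[OF s(1)] Lambda_DN_in_Lambda[OF p] h]
        H1_inner_add[OF Lambda_DN_in_Lambda[OF q_DN] Lambda_DN_in_Lambda[OF p] h] by simp
  qed
  then show "\<exists>s\<in>S. \<forall>h\<in>H. \<bar>H1_inner N s h - H1_inner N (\<lambda>i t. q i t + p i t) h\<bar> < \<epsilon>"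
    using S(2)[OF s(1)] by blast
qed

lemma DN_core_add_spin:
  assumes "0 < N" and q: "q \<in> DN_core N \<xi>"
  shows "add_spin N c q \<in> DN_core N \<xi>"
proof -
  have "Im (fst (spin N c (real k * pi / real N))) = 0" for k
    using \<open>0 < N\<close> by (simp add: spin_def)
  moreover have "Lambda_DN N (add_spin N c q)"
    using q \<open>0 < N\<close> by (intro Lambda_DN_add Lambda_DN_spin) (auto simp: DN_core_def)
  ultimately show ?thesis
    using q by (simp add: DN_core_def collision_free_def)
qed

lemma Lambda_DN_xi_add_spin:
  assumes "0 < N" and "q \<in> Lambda_DN_xi N \<xi>"
  shows "add_spin N c q \<in> Lambda_DN_xi N \<xi>"
  unfolding Lambda_DN_xi_def
proof (rule weak_closure_DN_add)
  show "q \<in> weak_closure_DN N (DN_core N \<xi>)" using assms(2) by (simp add: Lambda_DN_xi_def)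
  show "Lambda_DN N (\<lambda>i. spin N c)" by (intro Lambda_DN_spin \<open>0 < N\<close> dvd_refl)
  show "in_Lambda N s" if "s \<in> DN_core N \<xi>" for s
    using that by (simp add: DN_core_def Lambda_DN_in_Lambda)
  show "add_spin N c s \<in> DN_core N \<xi>" if "s \<in> DN_core N \<xi>" for s
    by (rule DN_core_add_spin[OF \<open>0 < N\<close> that])
qed

lemma action_add_spin:
  assumes q: "in_Lambda N q"
  shows "action N (real m) (add_spin m c q) 0 (2*pi) = action N (real m) q 0 (2*pi)"
proof -
  have "energy period_measure (rot_vel (real m) (\<lambda>t. f t + spin m c t))
      = energy period_measure (rot_vel (real m) f)"
    if f: "H1_loop f" for f
  proof (rule energy_cong_AE)
    show "sq_integrable period_measure (rot_vel (real m) (\<lambda>t. f t + spin m c t))"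
      by (intro sq_integrable_rot_vel H1_loop_add f H1_loop_spin)
    show "sq_integrable period_measure (rot_vel (real m) f)"
      by (rule sq_integrable_rot_vel[OF f])
    have "AE t in period_measure. wderiv (\<lambda>t. f t + spin m c t) t
        = wderiv f t + - coriolis (real m) (spin m c t)"
      by (rule wderiv_AE_eq[OF is_wderiv_add[OF H1_loop_wderiv[OF f] is_wderiv_spin]])
    then show "AE t in period_measure. rot_vel (real m) (\<lambda>t. f t + spin m c t) t = rot_vel (real m) f t"
      by eventually_elim
        (simp add: rot_vel_def linear_add[OF bounded_linear.linear[OF bounded_linear_coriolis]])
  qed
  then have "kinetic_action N (real m) (add_spin m c q) = kinetic_action N (real m) q"
    using q by (simp add: kinetic_action_def in_Lambda_def)
  moreover have "potential_action N (add_spin m c q) = potential_action N q"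
    by (simp add: potential_action_def potential_eq)
  moreover have "in_Lambda N (add_spin m c q)"
    using q H1_loop_spin by (simp add: in_Lambda_def H1_loop_add)
  ultimately show ?thesis
    by (simp add: action_eq q)
qed

lemma mean_z0_add_spin: "mean_z0 (add_spin m c q) = mean_z0 q"
  by (simp add: mean_z0_def spin_def)

lemma mean_x0_add_spin:
  assumes "0 < m" and q: "H1_loop (q 0)"
  shows "mean_x0 (add_spin m c q) = mean_x0 q"
proof -
  have "is_wderiv (\<lambda>t. c * sin (real m * t) / real m) (\<lambda>t. c * cos (real m * t))"
    using \<open>0 < m\<close> by (intro is_wderiv_C1) (auto intro!: derivative_eq_intros continuous_intros
        simp flip: has_real_derivative_iff_has_vector_derivative)
  from is_wderiv_integral[OF this, of 0 "2*pi"]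
  have zero: "(LINT t:{0..2*pi}|lborel. c * cos (real m * t)) = 0"
    using sin_int_2pin[of "int m"] by (simp add: mult_ac)
  have "(LINT t:{0..2*pi}|lborel. Re (fst (q 0 t + spin m c t)))
      = (LINT t:{0..2*pi}|lborel. Re (fst (q 0 t)) + c * cos (real m * t))"
    by (simp add: spin_def)
  also have "\<dots> = (LINT t:{0..2*pi}|lborel. Re (fst (q 0 t)))
      + (LINT t:{0..2*pi}|lborel. c * cos (real m * t))"
    by (intro set_integral_add(2) borel_integrable_atLeastAtMost' continuous_intros H1_loop_continuous_on q)
  finally show ?thesis unfolding mean_x0_def zero by simp
qed

section \<open>Coercivity under the mean constraints\<close>

lemma coerciveI:
  assumes "\<And>A. 0 \<le> A \<Longrightarrow> \<exists>B. \<forall>q\<in>S. action N \<omega> q 0 (2*pi) \<le> ennreal A \<longrightarrow>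
      (\<exists>p\<in>S. action N \<omega> p 0 (2*pi) = action N \<omega> q 0 (2*pi) \<and> (\<forall>t\<in>{0..2*pi}. norm (p 0 t) \<le> B))"
  shows "coercive N \<omega> S"
  unfolding coercive_def using assms by (metis order_refl)

lemma Lambda_DN_norm_le_action:
  assumes "0 < N" and q: "Lambda_DN N q" and mean: "mean_z0 q = 0" and "0 \<le> A"
    and act: "action N \<omega> q 0 (2*pi) \<le> ennreal A" and t: "t \<in> {0..2*pi}"
  shows "norm (q 0 t) \<le> cmod (fst (q 0 0)) + 4 * sqrt (pi * A)"
proof -
  have "norm (q 0 t) \<le> cmod (fst (q 0 0)) + 2 * rot_length \<omega> (q 0)"
    using mean by (intro norm_le_rot_length[OF Lambda_DN_H1_loop[OF q \<open>0 < N\<close>] _ t]) (simp add: mean_z0_def)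
  then show ?thesis
    using rot_length_le_action[OF Lambda_DN_in_Lambda[OF q] act \<open>0 \<le> A\<close> \<open>0 < N\<close>] by simp
qed

lemma cis_period_eq_1_iff: "cis (2*pi*\<omega>) = 1 \<longleftrightarrow> \<omega> \<in> \<int>"
proof
  assume "cis (2*pi*\<omega>) = 1"
  then have "cos (2*pi*\<omega>) = 1" by (simp add: complex_eq_iff)
  then obtain n :: int where "2*pi*\<omega> = of_int n * 2 * pi" by (auto simp: cos_one_2pi_int)
  then show "\<omega> \<in> \<int>" by simp
next
  assume "\<omega> \<in> \<int>"
  then show "cis (2*pi*\<omega>) = 1" using cis_add_int_period[of 0] by (auto elim!: Ints_cases)
qed

lemma coercive_nonintegral:
  assumes "0 < N" "\<omega> \<notin> \<int>" and S: "S \<subseteq> {q. Lambda_DN N q \<and> mean_z0 q = 0}"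
  shows "coercive N \<omega> S"
proof (rule coerciveI)
  fix A :: real assume "0 \<le> A"
  define e where "e = cmod (cis (2*pi*\<omega>) - 1)"
  have "0 < e" using \<open>\<omega> \<notin> \<int>\<close> by (simp add: e_def cis_period_eq_1_iff)
  have "norm (q 0 t) \<le> 2 * sqrt (pi * A) / e + 4 * sqrt (pi * A)"
    if q: "q \<in> S" and act: "action N \<omega> q 0 (2*pi) \<le> ennreal A" and t: "t \<in> {0..2*pi}" for q t
  proof -
    have q_DN: "Lambda_DN N q" "mean_z0 q = 0" using S q by auto
    have "e * cmod (fst (q 0 0)) \<le> rot_length \<omega> (q 0)"
      unfolding e_def by (rule norm_start_le_rot_length[OF Lambda_DN_H1_loop[OF q_DN(1) \<open>0 < N\<close>]])
    also have "\<dots> \<le> 2 * sqrt (pi * A)"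
      by (rule rot_length_le_action[OF Lambda_DN_in_Lambda[OF q_DN(1)] act \<open>0 \<le> A\<close> \<open>0 < N\<close>])
    finally have "cmod (fst (q 0 0)) \<le> 2 * sqrt (pi * A) / e"
      using \<open>0 < e\<close> by (simp add: field_simps)
    then show ?thesis
      using Lambda_DN_norm_le_action[OF \<open>0 < N\<close> q_DN \<open>0 \<le> A\<close> act t] by simp
  qed
  then show "\<exists>B. \<forall>q\<in>S. action N \<omega> q 0 (2*pi) \<le> ennreal A \<longrightarrow>
      (\<exists>p\<in>S. action N \<omega> p 0 (2*pi) = action N \<omega> q 0 (2*pi) \<and> (\<forall>t\<in>{0..2*pi}. norm (p 0 t) \<le> B))"
    by blast
qed

lemma Lambda_DN_start_real:
  assumes "0 < N" and q: "Lambda_DN N q" shows "Im (fst (q 0 0)) = 0"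
proof -
  have "q 0 (2*pi) = q 0 0"
    using Lambda_DN_H1_loop[OF q \<open>0 < N\<close>] by (metis H1_loop_def add_0)
  then have "q 0 0 = refl_xz (q 0 0)"
    using Lambda_DN_reflect[OF q, of 0] by simp
  then have "fst (q 0 0) = cnj (fst (q 0 0))" by (metis fst_conv refl_xz_def)
  then show ?thesis by (simp add: complex_eq_iff)
qed

lemma coercive_zero:
  assumes "0 < N" and S: "S \<subseteq> {q. Lambda_DN N q \<and> mean_x0 q = 0 \<and> mean_z0 q = 0}"
  shows "coercive N 0 S"
proof (rule coerciveI)
  fix A :: real assume "0 \<le> A"
  have "norm (q 0 t) \<le> 6 * sqrt (pi * A)"
    if q: "q \<in> S" and act: "action N 0 q 0 (2*pi) \<le> ennreal A" and t: "t \<in> {0..2*pi}" for q t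
  proof -
    have q_DN: "Lambda_DN N q" "mean_x0 q = 0" "mean_z0 q = 0" using S q by auto
    have "cmod (fst (q 0 0)) = \<bar>Re (fst (q 0 0))\<bar>"
      using Lambda_DN_start_real[OF \<open>0 < N\<close> q_DN(1)] by (simp add: cmod_def)
    also have "\<dots> \<le> rot_length 0 (q 0)"
      using q_DN(2) by (intro abs_Re_le_rot_length_zero Lambda_DN_H1_loop[OF q_DN(1) \<open>0 < N\<close>])
        (auto simp: mean_x0_def)
    also have "\<dots> \<le> 2 * sqrt (pi * A)"
      by (rule rot_length_le_action[OF Lambda_DN_in_Lambda[OF q_DN(1)] act \<open>0 \<le> A\<close> \<open>0 < N\<close>])
    finally show ?thesis
      using Lambda_DN_norm_le_action[OF \<open>0 < N\<close> q_DN(1,3) \<open>0 \<le> A\<close> act t] by simp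
  qed
  then show "\<exists>B. \<forall>q\<in>S. action N 0 q 0 (2*pi) \<le> ennreal A \<longrightarrow>
      (\<exists>p\<in>S. action N 0 p 0 (2*pi) = action N 0 q 0 (2*pi) \<and> (\<forall>t\<in>{0..2*pi}. norm (p 0 t) \<le> B))"
    by blast
qed

text \<open>No constraint on the means controls the kernel \<open>exp (- \<i>Nt)\<close> of the kinetic part, but
  subtracting a real multiple of it moves the starting point to the axis without changing the action.\<close>

lemma coercive_N:
  assumes "0 < N" and S: "S \<subseteq> {q. Lambda_DN N q \<and> mean_z0 q = 0}"
    and spin: "\<And>q c. q \<in> S \<Longrightarrow> add_spin N c q \<in> S"
  shows "coercive N (real N) S"
proof (rule coerciveI)
  fix A :: real assume "0 \<le> A"
  let ?act = "\<lambda>q. action N (real N) q 0 (2*pi)"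
  have "\<exists>p\<in>S. ?act p = ?act q \<and> (\<forall>t\<in>{0..2*pi}. norm (p 0 t) \<le> 4 * sqrt (pi * A))"
    if q: "q \<in> S" and act: "?act q \<le> ennreal A" for q
  proof -
    have q_DN: "Lambda_DN N q" using S q by auto
    define p where "p = add_spin N (- Re (fst (q 0 0))) q"
    have "p \<in> S" unfolding p_def by (rule spin[OF q])
    then have p_DN: "Lambda_DN N p" "mean_z0 p = 0" using S by auto
    have act_p: "?act p = ?act q"
      unfolding p_def by (rule action_add_spin[OF Lambda_DN_in_Lambda[OF q_DN]])
    have "fst (p 0 0) = 0"
      using Lambda_DN_start_real[OF \<open>0 < N\<close> q_DN] by (simp add: p_def spin_def complex_eq_iff)
    then have "norm (p 0 t) \<le> 4 * sqrt (pi * A)" if "t \<in> {0..2*pi}" for t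
      using Lambda_DN_norm_le_action[OF \<open>0 < N\<close> p_DN \<open>0 \<le> A\<close> _ that, of "real N"] act act_p by simp
    with \<open>p \<in> S\<close> act_p show ?thesis by blast
  qed
  then show "\<exists>B. \<forall>q\<in>S. ?act q \<le> ennreal A \<longrightarrow>
      (\<exists>p\<in>S. ?act p = ?act q \<and> (\<forall>t\<in>{0..2*pi}. norm (p 0 t) \<le> B))"
    by blast
qed

section \<open>Every sign class contains a collision-free loop\<close>

definition choreography :: "nat \<Rightarrow> (real \<Rightarrow> complex \<times> real) \<Rightarrow> loop" where
  "choreography N f i t = f (t + 2*pi * real i / real N)"

definition wave :: "real poly \<Rightarrow> real \<Rightarrow> complex \<times> real" where
  "wave P s = (complex_of_real (sin s * poly P (cos s)) * \<i>, cos s)"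

lemma wave_periodic: "wave P (s + 2*pi) = wave P s"
  by (simp add: wave_def)

lemma wave_reflect: "wave P (2*pi - s) = refl_xz (wave P s)"
  by (simp add: wave_def refl_xz_def)

lemma H1_loop_wave: "H1_loop (\<lambda>t. wave P (t + a))"
  unfolding H1_loop_def
proof (intro conjI allI exI)
  show "wave P (t + 2*pi + a) = wave P (t + a)" for t
    using wave_periodic[of P "t + a"] by (simp add: ac_simps)
  let ?y = "\<lambda>s. cos s * poly P (cos s) - sin s * (poly (pderiv P) (cos s) * sin s)"
  show "is_wderiv (\<lambda>t. wave P (t + a)) (\<lambda>t. (complex_of_real (?y (t + a)) * \<i>, - sin (t + a)))"
  proof (rule is_wderiv_C1)
    fix t
    have "((\<lambda>t. sin (t + a) * poly P (cos (t + a))) has_real_derivative ?y (t + a)) (at t)"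
      by (auto intro!: derivative_eq_intros DERIV_chain2[OF poly_DERIV])
    then have y: "((\<lambda>t. complex_of_real (sin (t + a) * poly P (cos (t + a))) * \<i>)
        has_vector_derivative complex_of_real (?y (t + a)) * \<i>) (at t)"
      by (intro has_vector_derivative_mult_left has_vector_derivative_of_real)
         (simp add: has_real_derivative_iff_has_vector_derivative)
    have "((\<lambda>t. cos (t + a)) has_real_derivative - sin (t + a)) (at t)"
      by (auto intro!: derivative_eq_intros)
    then show "((\<lambda>t. wave P (t + a)) has_vector_derivative
        (complex_of_real (?y (t + a)) * \<i>, - sin (t + a))) (at t)"
      unfolding wave_def
      by (intro has_vector_derivative_Pair y) (simp add: has_real_derivative_iff_has_vector_derivative)
  qed (auto intro!: continuous_intros)
qed

lemma Lambda_DN_wave: "Lambda_DN N (choreography N (wave P))"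
  unfolding Lambda_DN_def in_Lambda_def choreography_def[abs_def]
  using H1_loop_wave wave_reflect by simp

lemma cos_grid_point:
  assumes "0 < N" and s: "s = of_int m * pi / real N" and "sin s \<noteq> 0"
  obtains k where "k \<in> {1..N-1}" "cos s = cos (real k * pi / real N)"
proof -
  define \<theta> where "\<theta> = arccos (cos s)"
  have "(cos s)\<^sup>2 \<noteq> 1"
    using \<open>sin s \<noteq> 0\<close> by (simp add: cos_squared_eq)
  then have "cos s \<noteq> 1" "cos s \<noteq> -1" by auto
  then have \<theta>: "0 < \<theta>" "\<theta> < pi" "cos \<theta> = cos s"
    using arccos_lt_bounded[of "cos s"] cos_ge_minus_one[of s] cos_le_one[of s]
    by (auto simp: \<theta>_def less_le)
  obtain n :: int where "\<theta> = s + 2 * of_int n * pi \<or> \<theta> = - s + 2 * of_int n * pi"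
    using \<theta>(3) unfolding cos_eq by (auto elim: Ints_cases)
  then have "\<theta> = of_int (m + 2 * n * int N) * pi / real N \<or> \<theta> = of_int (- m + 2 * n * int N) * pi / real N"
    using \<open>0 < N\<close> by (auto simp: s field_simps)
  then obtain l :: int where l: "\<theta> = of_int l * pi / real N" by blast
  have "0 < l" "l < int N"
    using \<theta>(1,2) \<open>0 < N\<close> by (auto simp: l field_simps zero_less_mult_iff)
  then have "nat l \<in> {1..N-1}" "real (nat l) = of_int l" by auto
  then show ?thesis
    using that[of "nat l"] \<theta>(3) l by simp
qed

lemma phases_not_congruent:
  assumes "i < N" "j < N" "i \<noteq> j"
  shows "t + 2*pi * real i / real N \<noteq> t + 2*pi * real j / real N + 2*pi * of_int n"
proof
  assume "t + 2*pi * real i / real N = t + 2*pi * real j / real N + 2*pi * of_int n"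
  then have "2*pi * real i = 2*pi * (real j + of_int n * real N)"
    using assms(1) by (simp add: field_simps)
  then have "of_int (int i) = (of_int (int j + n * int N) :: real)" by simp
  then have "int i - int j = n * int N" unfolding of_int_eq_iff by simp
  then have "int N dvd int i - int j" by simp
  then show False
    using zdvd_imp_le[of "int N" "\<bar>int i - int j\<bar>"] assms by auto
qed

lemma wave_eq_cases:
  assumes "wave P s = wave P s'"
  obtains (congruent) n :: int where "s = s' + 2*pi * of_int n"
    | (reflected) n :: int where "s = - s' + 2*pi * of_int n" "sin s * poly P (cos s) = 0"
proof -
  have cos: "cos s = cos s'" and y: "sin s * poly P (cos s) = sin s' * poly P (cos s')"
    using arg_cong[OF assms, of snd] arg_cong[OF assms, of "\<lambda>p. Im (fst p)"] by (simp_all add: wave_def)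
  obtain n :: int where "s = s' + 2 * of_int n * pi \<or> s = - s' + 2 * of_int n * pi"
    using cos unfolding cos_eq by (auto elim: Ints_cases)
  then have "s = s' + 2*pi * of_int n \<or> s = - s' + 2*pi * of_int n"
    by (simp only: mult_ac)
  moreover have "sin s * poly P (cos s) = 0" if "s = - s' + 2*pi * of_int n"
    using sin.plus_of_int[of "- s'" n] y cos that by (simp add: mult.commute)
  ultimately show ?thesis using that by blast
qed

text \<open>At a collision of two bodies the phases are opposite modulo \<open>2\<pi>\<close>, hence multiples of
  \<open>\<pi> / N\<close>, where the polynomial does not vanish.\<close>

lemma collision_free_wave:
  assumes "0 < N" and P: "\<And>k. k \<in> {1..N-1} \<Longrightarrow> poly P (cos (real k * pi / real N)) \<noteq> 0"
  shows "collision_free N (choreography N (wave P))"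
  unfolding collision_free_def choreography_def
proof (intro allI impI notI)
  fix t i j assume ij: "i < N" "j < N" "i \<noteq> j"
    and eq: "wave P (t + 2*pi * real i / real N) = wave P (t + 2*pi * real j / real N)"
  define s s' where "s = t + 2*pi * real i / real N" and "s' = t + 2*pi * real j / real N"
  have not_congruent: "s \<noteq> s' + 2*pi * of_int n" for n
    unfolding s_def s'_def by (rule phases_not_congruent[OF ij])
  from eq have "wave P s = wave P s'" by (simp only: s_def s'_def)
  then show False
  proof (cases rule: wave_eq_cases)
    case (congruent n)
    then show False using not_congruent by blast
  next
    case (reflected n)
    have "sin s \<noteq> 0"
    proof
      assume "sin s = 0"
      then obtain l :: int where "s = of_int l * pi" by (auto simp: sin_zero_iff_int2)
      then have "s = s' + 2*pi * of_int (l - n)" using reflected(1) by (simp add: algebra_simps)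
      then show False using not_congruent by blast
    qed
    moreover have "s = of_int (n * int N + int i - int j) * pi / real N"
    proof -
      have "s - s' = 2*pi * (real i - real j) / real N"
        by (simp add: s_def s'_def diff_divide_distrib right_diff_distrib)
      then have "2 * s = 2*pi * of_int n + 2*pi * (real i - real j) / real N"
        using reflected(1) by simp
      then show ?thesis using \<open>0 < N\<close> by (simp add: field_simps)
    qed
    ultimately obtain k where "k \<in> {1..N-1}" "cos s = cos (real k * pi / real N)"
      using cos_grid_point[OF \<open>0 < N\<close>] by blast
    then show False using P reflected(2) \<open>sin s \<noteq> 0\<close> by simp
  qed
qed

lemma grid_angle:
  assumes "k \<in> {1..N-1}"
  shows "0 < real k * pi / real N" and "real k * pi / real N < pi"
  using assms by (auto simp: field_simps)

lemma wave_in_DN_core: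
  assumes "0 < N" and \<xi>: "\<And>k. k \<in> {1..N-1} \<Longrightarrow> \<xi> k \<in> {-1, 1}"
    and P: "\<And>k. k \<in> {1..N-1} \<Longrightarrow> poly P (cos (real k * pi / real N)) = \<xi> k"
  shows "choreography N (wave P) \<in> DN_core N \<xi>"
proof -
  have "sgn (Im (fst (choreography N (wave P) 0 (real k * pi / real N)))) = \<xi> k" if k: "k \<in> {1..N-1}" for k
  proof -
    have "Im (fst (choreography N (wave P) 0 (real k * pi / real N))) = sin (real k * pi / real N) * \<xi> k"
      using P[OF k] by (simp add: choreography_def wave_def)
    moreover have "0 < sin (real k * pi / real N)"
      using grid_angle[OF k] by (rule sin_gt_zero)
    ultimately show ?thesis using \<xi>[OF k] by (auto simp: sgn_mult)
  qed
  moreover have "poly P (cos (real k * pi / real N)) \<noteq> 0" if "k \<in> {1..N-1}" for k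
    using P[OF that] \<xi>[OF that] by auto
  ultimately show ?thesis
    using Lambda_DN_wave collision_free_wave[OF \<open>0 < N\<close>] by (simp add: DN_core_def)
qed

lemma means_wave: "mean_x0 (choreography N (wave P)) = 0" "mean_z0 (choreography N (wave P)) = 0"
proof -
  have "is_wderiv sin (cos :: real \<Rightarrow> real)"
    by (intro is_wderiv_C1) (auto intro!: derivative_eq_intros continuous_intros
        simp flip: has_real_derivative_iff_has_vector_derivative)
  from is_wderiv_integral[OF this, of 0 "2*pi"]
  show "mean_x0 (choreography N (wave P)) = 0" "mean_z0 (choreography N (wave P)) = 0"
    by (simp_all add: mean_x0_def mean_z0_def choreography_def wave_def)
qed

lemma weak_closure_DN_superset:
  assumes "q \<in> S" "Lambda_DN N q"
  shows "q \<in> weak_closure_DN N S"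
  unfolding weak_closure_DN_def using assms by (auto intro!: bexI[of _ q])

lemma polynomial_interpolation:
  fixes x c :: "'k \<Rightarrow> 'a::field"
  assumes "finite K" "inj_on x K"
  shows "\<exists>P. \<forall>k\<in>K. poly P (x k) = c k"
  using assms
proof (induction K rule: finite_induct)
  case (insert a K)
  then obtain P where P: "\<forall>k\<in>K. poly P (x k) = c k" by auto
  define R where "R = (\<Prod>k\<in>K. [:- x k, 1:])"
  have "poly R (x a) \<noteq> 0"
    using insert by (auto simp: R_def poly_prod)
  moreover have "poly R (x k) = 0" if "k \<in> K" for k
    using that insert by (auto simp: R_def poly_prod)
  ultimately have "\<forall>k\<in>insert a K. poly (P + smult ((c a - poly P (x a)) / poly R (x a)) R) (x k) = c k"
    using P by simp
  then show ?case by blast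
qed simp

lemma Lambda_DN_xi_nonempty:
  assumes "0 < N" and \<xi>: "\<And>k. k \<in> {1..N-1} \<Longrightarrow> \<xi> k \<in> {-1, 1}"
  obtains q where "q \<in> Lambda_DN_xi N \<xi>" "mean_x0 q = 0" "mean_z0 q = 0"
proof -
  have "inj_on (\<lambda>k. cos (real k * pi / real N)) {1..N-1}"
  proof (rule inj_onI)
    fix k l assume k: "k \<in> {1..N-1}" and l: "l \<in> {1..N-1}"
      and eq: "cos (real k * pi / real N) = cos (real l * pi / real N)"
    have "real k * pi / real N = real l * pi / real N"
      by (rule cos_inj_pi[OF _ _ _ _ eq]) (use grid_angle[OF k] grid_angle[OF l] in linarith)+
    then show "k = l" using \<open>0 < N\<close> by simp
  qed
  then obtain P where "\<And>k. k \<in> {1..N-1} \<Longrightarrow> poly P (cos (real k * pi / real N)) = \<xi> k"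
    using polynomial_interpolation[of "{1..N-1}" "\<lambda>k. cos (real k * pi / real N)" \<xi>] by blast
  then have "choreography N (wave P) \<in> DN_core N \<xi>"
    using \<open>0 < N\<close> \<xi> by (intro wave_in_DN_core)
  then have "choreography N (wave P) \<in> Lambda_DN_xi N \<xi>"
    unfolding Lambda_DN_xi_def using Lambda_DN_wave by (rule weak_closure_DN_superset)
  with means_wave show ?thesis by (intro that)
qed

section \<open>The minimisation theorem\<close>

lemma Lambda_DN_xi_Lambda_DN: "q \<in> Lambda_DN_xi N \<xi> \<Longrightarrow> Lambda_DN N q"
  by (simp add: Lambda_DN_xi_def weak_closure_DN_def)

lemma Lambda_DN_xi_means_add_spin:
  assumes "0 < N" and "q \<in> {q \<in> Lambda_DN_xi N \<xi>. mean_x0 q = 0 \<and> mean_z0 q = 0}"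
  shows "add_spin N c q \<in> {q \<in> Lambda_DN_xi N \<xi>. mean_x0 q = 0 \<and> mean_z0 q = 0}"
proof -
  have "H1_loop (q 0)"
    using assms by (auto intro: Lambda_DN_H1_loop Lambda_DN_xi_Lambda_DN)
  then show ?thesis
    using assms by (simp add: Lambda_DN_xi_add_spin mean_x0_add_spin mean_z0_add_spin)
qed

lemma weakly_closed_level_set:
  fixes \<phi> :: "loop \<Rightarrow> real"
  assumes S: "weakly_closed N S" and \<phi>: "\<And>q Q. weak_limit N q Q \<Longrightarrow> (\<lambda>n. \<phi> (q n)) \<longlonglongrightarrow> \<phi> Q"
  shows "weakly_closed N {q \<in> S. \<phi> q = c}"
  unfolding weakly_closed_def
proof (intro allI impI)
  fix q Q assume q: "\<forall>n. q n \<in> {q \<in> S. \<phi> q = c}" and lim: "weak_limit N q Q"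
  then have "\<phi> Q = c" using \<phi>[OF lim] by (simp add: LIMSEQ_const_iff)
  moreover have "Q \<in> S" using q by (intro weakly_closedD[OF S _ lim]) simp
  ultimately show "Q \<in> {q \<in> S. \<phi> q = c}" by simp
qed

lemma means_weak_limit:
  assumes "0 < N" and lim: "weak_limit N q Q"
  shows "(\<lambda>n. mean_x0 (q n)) \<longlonglongrightarrow> mean_x0 Q" and "(\<lambda>n. mean_z0 (q n)) \<longlonglongrightarrow> mean_z0 Q"
proof -
  have x: "mean_x0 p = 1 / (2*pi) * L2_inner period_measure (p 0) (\<lambda>t. (1, 0))" for p
    by (simp add: mean_x0_def L2_inner_def set_integral_interval inner_prod_def inner_complex_def)
  have z: "mean_z0 p = 1 / (2*pi) * L2_inner period_measure (p 0) (\<lambda>t. (0, 1))" for p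
    by (simp add: mean_z0_def L2_inner_def set_integral_interval inner_prod_def)
  show "(\<lambda>n. mean_x0 (q n)) \<longlonglongrightarrow> mean_x0 Q" "(\<lambda>n. mean_z0 (q n)) \<longlonglongrightarrow> mean_z0 Q"
    unfolding x z
    by (intro tendsto_mult_left interval_measure.sq_integrable_const
        H1_weak_limit_bounded_linear[OF weak_limit_component[OF lim \<open>0 < N\<close>] bounded_linear_ident])+
qed

lemma weakly_closed_Lambda_DN_xi_means:
  assumes "0 < N"
  shows "weakly_closed N {q \<in> Lambda_DN_xi N \<xi>. mean_z0 q = 0}"
    and "weakly_closed N {q \<in> Lambda_DN_xi N \<xi>. mean_x0 q = 0 \<and> mean_z0 q = 0}"
proof -
  note means = means_weak_limit[OF \<open>0 < N\<close>]
  have "weakly_closed N (Lambda_DN_xi N \<xi>)"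
    unfolding Lambda_DN_xi_def by (rule weakly_closed_weak_closure_DN[OF \<open>0 < N\<close>])
  then show z: "weakly_closed N {q \<in> Lambda_DN_xi N \<xi>. mean_z0 q = 0}"
    using means(2) by (rule weakly_closed_level_set)
  have "weakly_closed N {q \<in> {q \<in> Lambda_DN_xi N \<xi>. mean_z0 q = 0}. mean_x0 q = 0}"
    using z means(1) by (rule weakly_closed_level_set)
  then show "weakly_closed N {q \<in> Lambda_DN_xi N \<xi>. mean_x0 q = 0 \<and> mean_z0 q = 0}"
    by (rule back_subst[of "weakly_closed N"]) auto
qed

theorem mainTheorem3:
  fixes N :: nat and \<omega> :: real and \<xi> :: "nat \<Rightarrow> real"
  assumes "N \<ge> 2"
    and "0 \<le> \<omega>" and "\<omega> \<le> real N"
    and "\<forall>k\<in>{1..N-1}. \<xi> k \<in> {-1, 1}"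
  shows "(\<omega> \<notin> \<int> \<longrightarrow>
           (\<exists>q\<in>{q \<in> Lambda_DN_xi N \<xi>. mean_z0 q = 0}.
              \<forall>p\<in>{p \<in> Lambda_DN_xi N \<xi>. mean_z0 p = 0}.
                action N \<omega> q 0 (2*pi) \<le> action N \<omega> p 0 (2*pi)))
       \<and> (\<omega> \<in> {0, real N} \<longrightarrow>
           (\<exists>q\<in>{q \<in> Lambda_DN_xi N \<xi>. mean_x0 q = 0 \<and> mean_z0 q = 0}.
              \<forall>p\<in>{p \<in> Lambda_DN_xi N \<xi>. mean_x0 p = 0 \<and> mean_z0 p = 0}.
                action N \<omega> q 0 (2*pi) \<le> action N \<omega> p 0 (2*pi)))"
proof -
  let ?Z = "{q \<in> Lambda_DN_xi N \<xi>. mean_z0 q = 0}"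
    and ?XZ = "{q \<in> Lambda_DN_xi N \<xi>. mean_x0 q = 0 \<and> mean_z0 q = 0}"
  have N: "0 < N" using assms(1) by simp
  have DN: "?Z \<subseteq> {q. Lambda_DN N q}" "?XZ \<subseteq> {q. Lambda_DN N q}"
    using Lambda_DN_xi_Lambda_DN by blast+
  obtain q where "q \<in> ?XZ"
    using Lambda_DN_xi_nonempty[OF N] assms(4) by blast
  then have nonempty: "?Z \<noteq> {}" "?XZ \<noteq> {}" by auto
  have "coercive N \<omega> ?Z" if "\<omega> \<notin> \<int>"
    using DN(1) by (intro coercive_nonintegral N that) auto
  moreover have "coercive N \<omega> ?XZ" if "\<omega> \<in> {0, real N}"
  proof -
    have "coercive N 0 ?XZ"
      using DN(2) by (intro coercive_zero N) auto
    moreover have "coercive N (real N) ?XZ"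
      using DN(2) by (intro coercive_N N Lambda_DN_xi_means_add_spin) auto
    ultimately show ?thesis using that by auto
  qed
  ultimately show ?thesis
    using action_attains_minimum[OF N nonempty(1) DN(1) weakly_closed_Lambda_DN_xi_means(1)[OF N]]
      action_attains_minimum[OF N nonempty(2) DN(2) weakly_closed_Lambda_DN_xi_means(2)[OF N]] by blast
qed

end
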